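(* Let $\Gamma=(V,E)$ be a simplicial graph and $X$ a compact Hausdorff space. For each $v\in V$ let $G_v$ be a discrete group, $\alpha_v$ an action of $G_v$ on $X$ by homeomorphisms, and $\tilde h_v:G_v\rtimes X\to\mathbb{C}$ a unital positive definite function on the left transformation groupoid. Suppose that $\{\alpha_v\}_{v\in V}$ and $\{\tilde h_v\}_{v\in V}$ commute according to $\Gamma$. Then $\bigstar_\Gamma\tilde h_v:(\bigstar_\Gamma G_v)\rtimes X\to\mathbb{C}$ is positive definite.
   Context: A simplicial graph is undirected, without loops, with at most one edge between two vertices. For a discrete group $G$ acting on $X$ by $\alpha$, the left transformation groupoid $G\rtimes X$ is $G\times X$ where $(s,x)$ has source $x$ and range $\alpha_s(x)$, and $(s,\alpha_t(x))(t,x)=(st,x)$. A continuous function $\tilde h:G\rtimes X\to\mathbb{C}$ is positive definite if for every $x\in X$ and all elements $\eta_1,\dots,\eta_n$ with range $x$ the matrix $[\tilde h(\eta_i^{-1}\eta_j)]_{i,j}$ is positive semidefinite; it is unital if $\tilde h(e,x)=1$ for all $x$. With the induced action on $C(X)$, $(\alpha_sf)(x)=f(\alpha_{s^{-1}}(x))$, such functions correspond bijectively, via $\tilde h(s,x)=h_s(x)$, to positive definite multipliers $h:G\to C(X)$, i.e. maps such that $[\alpha_{x_j}(h_{x_i^{-1}x_j})]_{i,j}\ge0$ in $\mathbb{M}_n(C(X))$ for all $x_1,\dots,x_n\in G$. The graph product $\bigstar_\Gamma G_v$ is the free product of the $G_v$ modulo $[g,h]=1$ for $g\in G_v$, $h\in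 G_w$, $(v,w)\in E$. The actions commute according to $\Gamma$ if $\alpha_{v,g}\alpha_{w,h}=\alpha_{w,h}\alpha_{v,g}$ whenever $(v,w)\in E$, $g\in G_v$, $h\in G_w$; then there is a unique action $\alpha=\bigstar_\Gamma\alpha_v$ of $\bigstar_\Gamma G_v$ extending all $\alpha_v$. The functions $\tilde h_v$ commute according to $\Gamma$ if the corresponding multipliers $h_v$ do: whenever $(v,w)\in E$, $\alpha_{v,a}(h_{w,b})=h_{w,b}$ and $\alpha_{w,b}(h_{v,a})=h_{v,a}$ for all $a\in G_v$, $b\in G_w$. A word $(v_1,\dots,v_n)$ in $V$ is reduced if whenever $v_k=v_l$, $k<l$, there is $p$ with $k<p<l$ and $(v_k,v_p)\notin E$. Every $s\in\bigstar_\Gamma G_v$ has a reduced expression $s=s_1\cdots s_n$ with $s_j\in G_{v_j}\setminus\{e\}$ and $(v_1,\dots,v_n)$ reduced. Put $$(\bigstar_\Gamma h_v)_s=\alpha_{p_1}^{-1}(h_{v_1,s_1})\cdots\alpha_{p_{n-1}}^{-1}(h_{v_{n-1},s_{n-1}})h_{v_n,s_n},\quad p_j=s_{j+1}\cdots s_n,$$ $(\bigstar_\Gamma h_v)_e=1$ (independent of the reduced expression), and $(\bigstar_\Gamma\tilde h_v)(s,x)=(\bigstar_\Gamma h_v)_s(x)$. *)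

theory Defs
  imports "HOL-Analysis.Analysis" "HOL-Algebra.Group_Action"
begin

definition simplicial_graph :: "'v set \<Rightarrow> ('v \<times> 'v) set \<Rightarrow> bool" where
  "simplicial_graph V E \<longleftrightarrow> E \<subseteq> V \<times> V \<and> sym E \<and> irrefl E"


section \<open>Free products and graph products of groups\<close>

text \<open>A letter \<open>(v, g)\<close> stands for \<open>g \<in> G\<^sub>v\<close>; the tag \<open>v\<close> keeps the carriers of different vertex
  groups apart, even though they are all subsets of one type.\<close>

definition free_words :: "'v set \<Rightarrow> ('v \<Rightarrow> ('g, 'm) monoid_scheme) \<Rightarrow> ('v \<times> 'g) list set" where
  "free_words V G = lists (SIGMA v:V. carrier (G v))"

inductive_set free_step :: "'v set \<Rightarrow> ('v \<Rightarrow> ('g, 'm) monoid_scheme) \<Rightarrow> ('v \<times> 'g) list rel"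
  for V G where
  one: "\<lbrakk>u \<in> free_words V G; w \<in> free_words V G; v \<in> V\<rbrakk>
    \<Longrightarrow> (u @ (v, \<one>\<^bsub>G v\<^esub>) # w, u @ w) \<in> free_step V G"
| mult: "\<lbrakk>u \<in> free_words V G; w \<in> free_words V G; v \<in> V; g \<in> carrier (G v); h \<in> carrier (G v)\<rbrakk>
    \<Longrightarrow> (u @ (v, g) # (v, h) # w, u @ (v, g \<otimes>\<^bsub>G v\<^esub> h) # w) \<in> free_step V G"

definition free_equiv :: "'v set \<Rightarrow> ('v \<Rightarrow> ('g, 'm) monoid_scheme) \<Rightarrow> ('v \<times> 'g) list rel" where
  "free_equiv V G = (free_step V G \<union> (free_step V G)\<inverse>)\<^sup>* \<inter> free_words V G \<times> free_words V G"

definition free_product ::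
    "'v set \<Rightarrow> ('v \<Rightarrow> ('g, 'm) monoid_scheme) \<Rightarrow> ('v \<times> 'g) list set monoid" where
  "free_product V G =
    \<lparr>carrier = free_words V G // free_equiv V G,
     mult = (\<lambda>A B. \<Union>a\<in>A. \<Union>b\<in>B. free_equiv V G `` {a @ b}),
     one = free_equiv V G `` {[]}\<rparr>"

definition free_inj ::
    "'v set \<Rightarrow> ('v \<Rightarrow> ('g, 'm) monoid_scheme) \<Rightarrow> 'v \<Rightarrow> 'g \<Rightarrow> ('v \<times> 'g) list set" where
  "free_inj V G v g = free_equiv V G `` {[(v, g)]}"

definition normal_closure :: "('a, 'b) monoid_scheme \<Rightarrow> 'a set \<Rightarrow> 'a set" where
  "normal_closure F S = \<Inter>{N. N \<lhd> F \<and> S \<subseteq> N}"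

definition graph_commutators ::
    "'v set \<Rightarrow> ('v \<times> 'v) set \<Rightarrow> ('v \<Rightarrow> ('g, 'm) monoid_scheme) \<Rightarrow> ('v \<times> 'g) list set set" where
  "graph_commutators V E G =
    {free_inj V G v g \<otimes>\<^bsub>F\<^esub> free_inj V G w h
       \<otimes>\<^bsub>F\<^esub> inv\<^bsub>F\<^esub> (free_inj V G v g) \<otimes>\<^bsub>F\<^esub> inv\<^bsub>F\<^esub> (free_inj V G w h)
     | F v w g h. F = free_product V G \<and> (v, w) \<in> E \<and> g \<in> carrier (G v) \<and> h \<in> carrier (G w)}"

definition graph_product ::
    "'v set \<Rightarrow> ('v \<times> 'v) set \<Rightarrow> ('v \<Rightarrow> ('g, 'm) monoid_scheme) \<Rightarrow> ('v \<times> 'g) list set set monoid"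
  where
  "graph_product V E G =
    free_product V G Mod normal_closure (free_product V G) (graph_commutators V E G)"

definition graph_inj ::
    "'v set \<Rightarrow> ('v \<times> 'v) set \<Rightarrow> ('v \<Rightarrow> ('g, 'm) monoid_scheme)
      \<Rightarrow> 'v \<Rightarrow> 'g \<Rightarrow> ('v \<times> 'g) list set set" where
  "graph_inj V E G v g =
    normal_closure (free_product V G) (graph_commutators V E G)
      #>\<^bsub>free_product V G\<^esub> free_inj V G v g"

definition word_prod ::
    "'v set \<Rightarrow> ('v \<times> 'v) set \<Rightarrow> ('v \<Rightarrow> ('g, 'm) monoid_scheme)
      \<Rightarrow> ('v \<times> 'g) list \<Rightarrow> ('v \<times> 'g) list set set" where
  "word_prod V E G w =
    foldr (\<lambda>(v, g) p. graph_inj V E G v g \<otimes>\<^bsub>graph_product V E G\<^esub> p) w \<one>\<^bsub>graph_product V E G\<^esub>"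

definition reduced_word :: "('v \<times> 'v) set \<Rightarrow> 'v list \<Rightarrow> bool" where
  "reduced_word E vs \<longleftrightarrow>
    (\<forall>k l. k < l \<and> l < length vs \<and> vs ! k = vs ! l
       \<longrightarrow> (\<exists>p. k < p \<and> p < l \<and> (vs ! k, vs ! p) \<notin> E))"

definition reduced_expression ::
    "'v set \<Rightarrow> ('v \<times> 'v) set \<Rightarrow> ('v \<Rightarrow> ('g, 'm) monoid_scheme)
      \<Rightarrow> ('v \<times> 'g) list set set \<Rightarrow> ('v \<times> 'g) list \<Rightarrow> bool" where
  "reduced_expression V E G s w \<longleftrightarrow>
    set w \<subseteq> (SIGMA v:V. carrier (G v) - {\<one>\<^bsub>G v\<^esub>})
    \<and> reduced_word E (map fst w) \<and> word_prod V E G w = s"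


section \<open>Transformation groupoids and positive definite functions\<close>

definition homeo_action :: "('s, 'm) monoid_scheme \<Rightarrow> 'x topology \<Rightarrow> ('s \<Rightarrow> 'x \<Rightarrow> 'x) \<Rightarrow> bool" where
  "homeo_action G X \<alpha> \<longleftrightarrow>
    group_action G (topspace X) \<alpha> \<and> (\<forall>s \<in> carrier G. homeomorphic_map X X (\<alpha> s))"

text \<open>An arrow \<open>(s, x)\<close> goes from \<open>x\<close> to \<open>\<alpha>\<^sub>s(x)\<close>. The product of \<open>\<eta>\<close> and \<open>\<theta>\<close> is
  only meaningful when the range of \<open>\<theta>\<close> is the source of \<open>\<eta>\<close>.\<close>

definition tg_arrows :: "('s, 'm) monoid_scheme \<Rightarrow> 'x topology \<Rightarrow> ('s \<times> 'x) set" where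
  "tg_arrows G X = carrier G \<times> topspace X"

definition tg_range :: "('s \<Rightarrow> 'x \<Rightarrow> 'x) \<Rightarrow> 's \<times> 'x \<Rightarrow> 'x" where
  "tg_range \<alpha> \<eta> = \<alpha> (fst \<eta>) (snd \<eta>)"

definition tg_mult :: "('s, 'm) monoid_scheme \<Rightarrow> 's \<times> 'x \<Rightarrow> 's \<times> 'x \<Rightarrow> 's \<times> 'x" where
  "tg_mult G \<eta> \<theta> = (fst \<eta> \<otimes>\<^bsub>G\<^esub> fst \<theta>, snd \<theta>)"

definition tg_inv :: "('s, 'm) monoid_scheme \<Rightarrow> ('s \<Rightarrow> 'x \<Rightarrow> 'x) \<Rightarrow> 's \<times> 'x \<Rightarrow> 's \<times> 'x" where
  "tg_inv G \<alpha> \<eta> = (inv\<^bsub>G\<^esub> (fst \<eta>), tg_range \<alpha> \<eta>)"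

text \<open>Membership in \<open>\<real>\<^sub>\<ge>\<^sub>0\<close> says that the value of the form is real and nonnegative.\<close>

definition psd_matrix :: "nat \<Rightarrow> (nat \<Rightarrow> nat \<Rightarrow> complex) \<Rightarrow> bool" where
  "psd_matrix n A \<longleftrightarrow>
    (\<forall>c :: nat \<Rightarrow> complex. (\<Sum>i<n. \<Sum>j<n. cnj (c i) * A i j * c j) \<in> \<real>\<^sub>\<ge>\<^sub>0)"

definition tg_positive_definite ::
    "('s, 'm) monoid_scheme \<Rightarrow> 'x topology \<Rightarrow> ('s \<Rightarrow> 'x \<Rightarrow> 'x) \<Rightarrow> ('s \<times> 'x \<Rightarrow> complex) \<Rightarrow> bool"
  where
  "tg_positive_definite G X \<alpha> ht \<longleftrightarrow>
    continuous_map (prod_topology (discrete_topology (carrier G)) X) euclidean ht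
    \<and> (\<forall>x \<in> topspace X. \<forall>n. \<forall>\<eta> :: nat \<Rightarrow> 's \<times> 'x.
         (\<forall>i<n. \<eta> i \<in> tg_arrows G X \<and> tg_range \<alpha> (\<eta> i) = x)
         \<longrightarrow> psd_matrix n (\<lambda>i j. ht (tg_mult G (tg_inv G \<alpha> (\<eta> i)) (\<eta> j))))"

definition tg_unital :: "('s, 'm) monoid_scheme \<Rightarrow> 'x topology \<Rightarrow> ('s \<times> 'x \<Rightarrow> complex) \<Rightarrow> bool" where
  "tg_unital G X ht \<longleftrightarrow> (\<forall>x \<in> topspace X. ht (\<one>\<^bsub>G\<^esub>, x) = 1)"

text \<open>The action on functions induced by an action on the space. The function \<open>h\<^sub>s\<close> associated with
  a function \<open>ht\<close> on the groupoid is \<open>curry ht s\<close>.\<close>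

definition induced_action ::
    "('s, 'm) monoid_scheme \<Rightarrow> ('s \<Rightarrow> 'x \<Rightarrow> 'x) \<Rightarrow> 's \<Rightarrow> ('x \<Rightarrow> complex) \<Rightarrow> 'x \<Rightarrow> complex" where
  "induced_action G \<alpha> s f = (\<lambda>x. f (\<alpha> (inv\<^bsub>G\<^esub> s) x))"


section \<open>Graph products of actions and of positive definite functions\<close>

definition actions_commute ::
    "('v \<times> 'v) set \<Rightarrow> ('v \<Rightarrow> ('g, 'm) monoid_scheme) \<Rightarrow> 'x topology
      \<Rightarrow> ('v \<Rightarrow> 'g \<Rightarrow> 'x \<Rightarrow> 'x) \<Rightarrow> bool" where
  "actions_commute E G X \<alpha> \<longleftrightarrow>
    (\<forall>(v, w) \<in> E. \<forall>g \<in> carrier (G v). \<forall>h \<in> carrier (G w). \<forall>x \<in> topspace X.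
       \<alpha> v g (\<alpha> w h x) = \<alpha> w h (\<alpha> v g x))"

definition multipliers_commute ::
    "('v \<times> 'v) set \<Rightarrow> ('v \<Rightarrow> ('g, 'm) monoid_scheme) \<Rightarrow> 'x topology
      \<Rightarrow> ('v \<Rightarrow> 'g \<Rightarrow> 'x \<Rightarrow> 'x) \<Rightarrow> ('v \<Rightarrow> 'g \<Rightarrow> 'x \<Rightarrow> complex) \<Rightarrow> bool" where
  "multipliers_commute E G X \<alpha> h \<longleftrightarrow>
    (\<forall>(v, w) \<in> E. \<forall>a \<in> carrier (G v). \<forall>b \<in> carrier (G w). \<forall>x \<in> topspace X.
       induced_action (G v) (\<alpha> v) a (h w b) x = h w b x
       \<and> induced_action (G w) (\<alpha> w) b (h v a) x = h v a x)"

text \<open>The unique action of the graph product extending all \<open>\<alpha> v\<close> (lemma \<open>graph_action_ex1\<close> below). Extensionality on the carrier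
  only fixes the values at arguments outside the group, so that the description is unique.\<close>

definition graph_action ::
    "'v set \<Rightarrow> ('v \<times> 'v) set \<Rightarrow> ('v \<Rightarrow> ('g, 'm) monoid_scheme) \<Rightarrow> 'x topology
      \<Rightarrow> ('v \<Rightarrow> 'g \<Rightarrow> 'x \<Rightarrow> 'x) \<Rightarrow> ('v \<times> 'g) list set set \<Rightarrow> 'x \<Rightarrow> 'x" where
  "graph_action V E G X \<alpha> =
    (THE \<beta>. homeo_action (graph_product V E G) X \<beta>
       \<and> \<beta> \<in> extensional (carrier (graph_product V E G))
       \<and> (\<forall>v \<in> V. \<forall>g \<in> carrier (G v). \<beta> (graph_inj V E G v g) = \<alpha> v g))"

text \<open>The factor of index \<open>j\<close> is \<open>\<beta>\<^sub>p\<inverse>(h\<^sub>v\<^sub>,\<^sub>s)\<close>, where \<open>(v, s)\<close> is the letter of index \<open>j\<close>, \<open>p\<close> is the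
  product of the letters to its right and \<open>\<beta>\<^sub>p\<inverse>\<close> is written as the action of the inverse of \<open>p\<close>. For the
  last letter \<open>p\<close> is the neutral element.\<close>

definition word_multiplier ::
    "'v set \<Rightarrow> ('v \<times> 'v) set \<Rightarrow> ('v \<Rightarrow> ('g, 'm) monoid_scheme) \<Rightarrow> 'x topology
      \<Rightarrow> ('v \<Rightarrow> 'g \<Rightarrow> 'x \<Rightarrow> 'x) \<Rightarrow> ('v \<Rightarrow> 'g \<Rightarrow> 'x \<Rightarrow> complex)
      \<Rightarrow> ('v \<times> 'g) list \<Rightarrow> 'x \<Rightarrow> complex" where
  "word_multiplier V E G X \<alpha> h w x =
    (\<Prod>j<length w.
       induced_action (graph_product V E G) (graph_action V E G X \<alpha>)
         (inv\<^bsub>graph_product V E G\<^esub> (word_prod V E G (drop (Suc j) w)))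
         (h (fst (w ! j)) (snd (w ! j))) x)"

text \<open>The value does not depend on the reduced expression, so an arbitrary one is chosen.\<close>

definition graph_multiplier ::
    "'v set \<Rightarrow> ('v \<times> 'v) set \<Rightarrow> ('v \<Rightarrow> ('g, 'm) monoid_scheme) \<Rightarrow> 'x topology
      \<Rightarrow> ('v \<Rightarrow> 'g \<Rightarrow> 'x \<Rightarrow> 'x) \<Rightarrow> ('v \<Rightarrow> 'g \<Rightarrow> 'x \<Rightarrow> complex)
      \<Rightarrow> ('v \<times> 'g) list set set \<Rightarrow> 'x \<Rightarrow> complex" where
  "graph_multiplier V E G X \<alpha> h s =
    (if s = \<one>\<^bsub>graph_product V E G\<^esub> then (\<lambda>x. 1)
     else word_multiplier V E G X \<alpha> h (SOME w. reduced_expression V E G s w))"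

definition graph_tg_function ::
    "'v set \<Rightarrow> ('v \<times> 'v) set \<Rightarrow> ('v \<Rightarrow> ('g, 'm) monoid_scheme) \<Rightarrow> 'x topology
      \<Rightarrow> ('v \<Rightarrow> 'g \<Rightarrow> 'x \<Rightarrow> 'x) \<Rightarrow> ('v \<Rightarrow> 'g \<times> 'x \<Rightarrow> complex)
      \<Rightarrow> ('v \<times> 'g) list set set \<times> 'x \<Rightarrow> complex" where
  "graph_tg_function V E G X \<alpha> ht =
    (\<lambda>(s, x). graph_multiplier V E G X \<alpha> (\<lambda>v. curry (ht v)) s x)"


section \<open>Universal properties, and existence and uniqueness of the extended action\<close>

lemma free_step_words: "(a,b) \<in> free_step V G \<Longrightarrow> (\<And>v. v \<in> V \<Longrightarrow> group (G v)) \<Longrightarrow> a \<in> free_words V G \<and> b \<in> free_words V G"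
  by (induction rule: free_step.induct) (auto simp: free_words_def group.is_monoid monoid.m_closed)

lemma free_step_app:
  assumes "(a,b) \<in> free_step V G" "c \<in> free_words V G" "d \<in> free_words V G"
  shows "(c @ a @ d, c @ b @ d) \<in> free_step V G"
  using assms
proof (induction rule: free_step.induct)
  case (one u w v)
  then show ?case using free_step.one[of "c@u" V G "w@d" v] by (auto simp: free_words_def)
next
  case (mult u w v g h)
  then show ?case using free_step.mult[of "c@u" V G "w@d" v g h] by (auto simp: free_words_def)
qed

lemma equiv_free_equiv: "equiv (free_words V G) (free_equiv V G)"
proof -
  let ?R = "(free_step V G \<union> (free_step V G)\<inverse>)\<^sup>*"
  have s: "sym ?R" by (simp add: sym_Un_converse sym_rtrancl)
  have t: "trans ?R" by (rule trans_rtrancl)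
  show ?thesis
    unfolding free_equiv_def
  proof (rule equivI)
    show "?R \<inter> free_words V G \<times> free_words V G \<subseteq> free_words V G \<times> free_words V G" by blast
    show "refl_on (free_words V G) (?R \<inter> free_words V G \<times> free_words V G)"
      by (simp add: refl_on_def)
    show "sym (?R \<inter> free_words V G \<times> free_words V G)" using symD[OF s] by (blast intro: symI)
    show "trans (?R \<inter> free_words V G \<times> free_words V G)" using transD[OF t] by (blast intro: transI)
  qed
qed

lemma free_equiv_refl: "w \<in> free_words V G \<Longrightarrow> (w,w) \<in> free_equiv V G"
  by (simp add: free_equiv_def)

lemma free_equiv_trans: "(a,b) \<in> free_equiv V G \<Longrightarrow> (b,c) \<in> free_equiv V G \<Longrightarrow> (a,c) \<in> free_equiv V G"
  using equiv_free_equiv[of V G] by (meson equivE transD)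

lemma free_equiv_step: "(a,b) \<in> free_step V G \<Longrightarrow> (\<And>v. v \<in> V \<Longrightarrow> group (G v)) \<Longrightarrow> (a,b) \<in> free_equiv V G"
  using free_step_words[of a b V G] unfolding free_equiv_def by (simp add: r_into_rtrancl)

lemma free_equiv_app:
  assumes "(a,b) \<in> free_equiv V G" "c \<in> free_words V G" "d \<in> free_words V G"
  shows "(c @ a @ d, c @ b @ d) \<in> free_equiv V G"
proof -
  have "(c @ a @ d, c @ b @ d) \<in> (free_step V G \<union> (free_step V G)\<inverse>)\<^sup>*"
    if "(a,b) \<in> (free_step V G \<union> (free_step V G)\<inverse>)\<^sup>*"
    using that
  proof (induction rule: rtrancl_induct)
    case (step y z)
    then have "(c @ y @ d, c @ z @ d) \<in> (free_step V G \<union> (free_step V G)\<inverse>)"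
      using free_step_app assms by blast
    with step show ?case by (meson rtrancl.rtrancl_into_rtrancl)
  qed auto
  then show ?thesis using assms unfolding free_equiv_def by (auto simp: free_words_def)
qed

lemma free_equiv_cong:
  assumes "(a,a') \<in> free_equiv V G" "(b,b') \<in> free_equiv V G"
  shows "(a @ b, a' @ b') \<in> free_equiv V G"
proof -
  have W: "a \<in> free_words V G" "b' \<in> free_words V G" "b \<in> free_words V G" "a' \<in> free_words V G"
    using assms by (simp_all add: free_equiv_def)
  have n: "[] \<in> free_words V G" by (simp add: free_words_def)
  show ?thesis
    using free_equiv_trans[of "a @ b" "a' @ b" V G "a' @ b'"]
      free_equiv_app[OF assms(2) W(4) n] free_equiv_app[OF assms(1) n W(3)] by simp
qed

abbreviation "free_class V G w \<equiv> free_equiv V G `` {w}"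

lemma free_class_eqI: "(a,b) \<in> free_equiv V G \<Longrightarrow> free_class V G a = free_class V G b"
  by (rule equiv_class_eq[OF equiv_free_equiv])

lemma free_class_mult:
  assumes "a \<in> free_words V G" "b \<in> free_words V G"
  shows "free_class V G a \<otimes>\<^bsub>free_product V G\<^esub> free_class V G b = free_class V G (a @ b)"
proof -
  have 1: "free_class V G (x @ y) = free_class V G (a @ b)" if "x \<in> free_class V G a" "y \<in> free_class V G b" for x y
    using free_class_eqI[OF free_equiv_cong[of a x V G b y]] that by simp
  have 2: "a \<in> free_class V G a" "b \<in> free_class V G b"
    using assms by (simp_all add: free_equiv_refl)
  have "(\<Union>x\<in>free_class V G a. \<Union>y\<in>free_class V G b. free_class V G (x @ y)) = (\<Union>x\<in>free_class V G a. \<Union>y\<in>free_class V G b. free_class V G (a @ b))"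
    by (intro SUP_cong refl 1)
  also have "\<dots> = free_class V G (a @ b)" using 2 by blast
  finally show ?thesis by (simp add: free_product_def)
qed

lemma carrier_free: "carrier (free_product V G) = free_class V G ` free_words V G"
  by (simp add: free_product_def quotient_def UNION_singleton_eq_range)

lemma one_free: "\<one>\<^bsub>free_product V G\<^esub> = free_class V G []"
  by (simp add: free_product_def)

lemma free_words_append: "a @ b \<in> free_words V G \<longleftrightarrow> a \<in> free_words V G \<and> b \<in> free_words V G"
  by (auto simp: free_words_def)

lemma free_linv:
  assumes G: "\<And>v. v \<in> V \<Longrightarrow> group (G v)" and "w \<in> free_words V G"
  shows "\<exists>w' \<in> free_words V G. (w' @ w, []) \<in> free_equiv V G"
  using assms(2)
proof (induction w)
  case Nil
  then show ?case by (auto simp: free_words_def intro!: free_equiv_refl bexI[of _ "[]"])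
next
  case (Cons p w)
  obtain v g where p: "p = (v,g)" by force
  have v: "v \<in> V" "g \<in> carrier (G v)" and w: "w \<in> free_words V G"
    using Cons.prems by (auto simp: p free_words_def)
  interpret group "G v" using G v by auto
  obtain w' where w': "w' \<in> free_words V G" "(w' @ w, []) \<in> free_equiv V G" using Cons w by auto
  have iv: "inv\<^bsub>G v\<^esub> g \<in> carrier (G v)" using v by auto
  have 1: "(w' @ (v, inv\<^bsub>G v\<^esub> g) # (v,g) # w, w' @ (v, \<one>\<^bsub>G v\<^esub>) # w) \<in> free_equiv V G"
    using free_equiv_step[OF free_step.mult[OF w'(1) w v(1) iv v(2)] G] v by simp
  have 2: "(w' @ (v, \<one>\<^bsub>G v\<^esub>) # w, w' @ w) \<in> free_equiv V G"
    using free_equiv_step[OF free_step.one[OF w'(1) w v(1)] G] by simp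
  have "((w' @ [(v, inv\<^bsub>G v\<^esub> g)]) @ p # w, []) \<in> free_equiv V G"
    using free_equiv_trans[OF free_equiv_trans[OF 1 2] w'(2)] by (simp add: p)
  moreover have "w' @ [(v, inv\<^bsub>G v\<^esub> g)] \<in> free_words V G"
    using w' v by (auto simp: free_words_def)
  ultimately show ?case by blast
qed

lemma group_free_product:
  assumes G: "\<And>v. v \<in> V \<Longrightarrow> group (G v)"
  shows "group (free_product V G)"
proof (rule groupI)
  have n: "[] \<in> free_words V G" by (simp add: free_words_def)
  show "\<one>\<^bsub>free_product V G\<^esub> \<in> carrier (free_product V G)" by (simp add: carrier_free one_free n)
  fix x assume "x \<in> carrier (free_product V G)"
  then obtain w where w: "w \<in> free_words V G" "x = free_class V G w" unfolding carrier_free by (rule imageE)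
  show "\<one>\<^bsub>free_product V G\<^esub> \<otimes>\<^bsub>free_product V G\<^esub> x = x"
    by (simp add: one_free n free_class_mult w)
  obtain w' where w': "w' \<in> free_words V G" "(w' @ w, []) \<in> free_equiv V G"
    using free_linv[OF G w(1)] by metis
  show "\<exists>y\<in>carrier (free_product V G). y \<otimes>\<^bsub>free_product V G\<^esub> x = \<one>\<^bsub>free_product V G\<^esub>"
  proof (rule bexI)
    show "free_class V G w' \<otimes>\<^bsub>free_product V G\<^esub> x = \<one>\<^bsub>free_product V G\<^esub>"
      by (simp only: w free_class_mult[OF w'(1) w(1)] one_free free_class_eqI[OF w'(2)])
    show "free_class V G w' \<in> carrier (free_product V G)" using w' by (simp add: carrier_free)
  qed
  fix y assume "y \<in> carrier (free_product V G)"
  then obtain v where v: "v \<in> free_words V G" "y = free_class V G v" unfolding carrier_free by (rule imageE)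
  show "x \<otimes>\<^bsub>free_product V G\<^esub> y \<in> carrier (free_product V G)"
    using w v by (simp add: free_class_mult carrier_free free_words_append)
  fix z assume "z \<in> carrier (free_product V G)"
  then obtain u where u: "u \<in> free_words V G" "z = free_class V G u" unfolding carrier_free by (rule imageE)
  show "x \<otimes>\<^bsub>free_product V G\<^esub> y \<otimes>\<^bsub>free_product V G\<^esub> z
      = x \<otimes>\<^bsub>free_product V G\<^esub> (y \<otimes>\<^bsub>free_product V G\<^esub> z)"
    using w v u by (simp add: free_class_mult free_words_append)
qed

lemma normal_normal_closure:
  assumes "group F" "S \<subseteq> carrier F"
  shows "normal_closure F S \<lhd> F"
proof -
  interpret group F by fact
  have c: "carrier F \<lhd> F" by (simp add: normal_inv_iff subgroup_self)
  show ?thesis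
    unfolding normal_closure_def normal_inv_iff
    using c assms(2) by (auto intro!: subgroups_Inter simp: normal_inv_iff)
qed

lemma free_inj_closed: "v \<in> V \<Longrightarrow> g \<in> carrier (G v) \<Longrightarrow> free_inj V G v g \<in> carrier (free_product V G)"
  by (auto simp: free_inj_def carrier_free free_words_def)

lemma graph_commutators_closed:
  assumes G: "\<And>v. v \<in> V \<Longrightarrow> group (G v)" and "E \<subseteq> V \<times> V"
  shows "graph_commutators V E G \<subseteq> carrier (free_product V G)"
proof -
  interpret group "free_product V G" by (rule group_free_product[OF G])
  show ?thesis using assms(2) by (auto simp: graph_commutators_def intro!: free_inj_closed)
qed

lemma group_graph_product:
  assumes G: "\<And>v. v \<in> V \<Longrightarrow> group (G v)" and E: "E \<subseteq> V \<times> V"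
  shows "group (graph_product V E G)"
  unfolding graph_product_def
  by (intro normal.factorgroup_is_group normal_normal_closure group_free_product graph_commutators_closed assms)

lemma free_class_Cons:
  assumes "(v,g) # w \<in> free_words V G"
  shows "free_class V G ((v,g) # w) = free_inj V G v g \<otimes>\<^bsub>free_product V G\<^esub> free_class V G w"
  using assms free_class_mult[of "[(v,g)]" V G w] by (auto simp: free_inj_def free_words_def)

lemma free_product_universal:
  assumes G: "\<And>v. v \<in> V \<Longrightarrow> group (G v)" and "group H"
    and f: "\<And>v. v \<in> V \<Longrightarrow> f v \<in> hom (G v) H"
  shows "\<exists>F \<in> hom (free_product V G) H. \<forall>v \<in> V. \<forall>g \<in> carrier (G v). F (free_inj V G v g) = f v g"
proof -
  interpret H: group H by fact
  define act where "act w = foldr (\<lambda>(v,g) p. f v g \<otimes>\<^bsub>H\<^esub> p) w \<one>\<^bsub>H\<^esub>" for w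
  have fc: "f v g \<in> carrier H" if "v \<in> V" "g \<in> carrier (G v)" for v g using f that by (auto simp: hom_def)
  have ac: "act w \<in> carrier H" if "w \<in> free_words V G" for w
    using that by (induction w) (auto simp: act_def free_words_def fc)
  have aa: "act (u @ w) = act u \<otimes>\<^bsub>H\<^esub> act w" if "u \<in> free_words V G" "w \<in> free_words V G" for u w
    using that
  proof (induction u)
    case Nil then show ?case using ac[of w] by (simp add: act_def)
  next
    case (Cons p u)
    have "u \<in> free_words V G" using Cons.prems by (auto simp: free_words_def)
    then show ?case using Cons fc ac[of u] ac[of w] by (auto simp: act_def H.m_assoc free_words_def)
  qed
  have as: "act a = act b" if "(a,b) \<in> free_step V G" for a b
    using that
  proof (induction)
    case (one u w v)
    have "(v, \<one>\<^bsub>G v\<^esub>) # w \<in> free_words V G"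
      using one G[of v] by (auto simp: free_words_def group.is_monoid)
    moreover have "act ((v, \<one>\<^bsub>G v\<^esub>) # w) = act w"
      using one ac[of w] hom_one[OF f G assms(2)] by (simp add: act_def)
    ultimately show ?case using one by (simp add: aa)
  next
    case (mult u w v g h)
    have W: "(v, g) # (v,h) # w \<in> free_words V G" "(v, g \<otimes>\<^bsub>G v\<^esub> h) # w \<in> free_words V G"
      using mult G[of v] by (auto simp: free_words_def group.is_monoid monoid.m_closed)
    moreover have "f v (g \<otimes>\<^bsub>G v\<^esub> h) = f v g \<otimes>\<^bsub>H\<^esub> f v h"
      using f mult by (auto simp: hom_def)
    then have "act ((v, g) # (v,h) # w) = act ((v, g \<otimes>\<^bsub>G v\<^esub> h) # w)"
      using mult ac[of w] fc[of v] by (simp add: act_def H.m_assoc)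
    ultimately show ?case using mult by (simp add: aa)
  qed
  have ae: "act a = act b" if "(a,b) \<in> (free_step V G \<union> (free_step V G)\<inverse>)\<^sup>*" for a b
    using that
  proof (induction rule: rtrancl_induct)
    case (step y z)
    then have "act y = act z" using as[of y z] as[of z y] by (elim UnE) simp_all
    then show ?case using step by simp
  qed simp
  define F where "F A = the_elem (act ` A)" for A
  have F: "F (free_class V G w) = act w" if "w \<in> free_words V G" for w
  proof -
    have 1: "w \<in> free_class V G w" using free_equiv_refl[OF that] by simp
    have 2: "act a = act w" if "a \<in> free_class V G w" for a
      using that ae[of w a] unfolding free_equiv_def by simp
    have "act ` free_class V G w = (\<lambda>_. act w) ` free_class V G w" by (rule image_cong[OF refl 2])
    also have "\<dots> = {act w}" using 1 by (rule image_constant)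
    finally have "act ` free_class V G w = {act w}" .
    then show ?thesis by (simp add: F_def)
  qed
  show ?thesis
  proof (intro bexI[of _ F] ballI)
    show "F \<in> hom (free_product V G) H"
    proof (rule homI)
      fix x assume "x \<in> carrier (free_product V G)"
      then obtain w where w: "w \<in> free_words V G" "x = free_class V G w" unfolding carrier_free by (rule imageE)
      show "F x \<in> carrier H" using w by (simp add: F ac)
      fix y assume "y \<in> carrier (free_product V G)"
      then obtain v where v: "v \<in> free_words V G" "y = free_class V G v" unfolding carrier_free by (rule imageE)
      show "F (x \<otimes>\<^bsub>free_product V G\<^esub> y) = F x \<otimes>\<^bsub>H\<^esub> F y"
        using w v by (simp add: free_class_mult F aa free_words_append)
    qed
    fix v g assume "v \<in> V" "g \<in> carrier (G v)"
    then show "F (free_inj V G v g) = f v g"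
      using F[of "[(v,g)]"] fc by (simp add: free_inj_def free_words_def act_def)
  qed
qed

lemma graph_product_universal:
  assumes G: "\<And>v. v \<in> V \<Longrightarrow> group (G v)" and E: "E \<subseteq> V \<times> V" and "group H"
    and f: "\<And>v. v \<in> V \<Longrightarrow> f v \<in> hom (G v) H"
    and comm: "\<And>v w g h. (v,w) \<in> E \<Longrightarrow> g \<in> carrier (G v) \<Longrightarrow> h \<in> carrier (G w)
      \<Longrightarrow> f v g \<otimes>\<^bsub>H\<^esub> f w h = f w h \<otimes>\<^bsub>H\<^esub> f v g"
  shows "\<exists>F \<in> hom (graph_product V E G) H. \<forall>v \<in> V. \<forall>g \<in> carrier (G v). F (graph_inj V E G v g) = f v g"
proof -
  interpret H: group H by fact
  obtain F where F: "F \<in> hom (free_product V G) H"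
    and Ff: "\<And>v g. v \<in> V \<Longrightarrow> g \<in> carrier (G v) \<Longrightarrow> F (free_inj V G v g) = f v g"
  proof -
    have "\<exists>F \<in> hom (free_product V G) H. \<forall>v \<in> V. \<forall>g \<in> carrier (G v). F (free_inj V G v g) = f v g"
      by (rule free_product_universal) (fact G \<open>group H\<close> f)+
    then show thesis using that by (elim bexE) simp
  qed
  interpret gh: group_hom "free_product V G" H F
    by (intro group_hom.intro group_hom_axioms.intro F group_free_product G H.is_group)
  let ?N = "normal_closure (free_product V G) (graph_commutators V E G)"
  have "graph_commutators V E G \<subseteq> kernel (free_product V G) H F"
  proof
    fix c assume "c \<in> graph_commutators V E G"
    then obtain v w g h where c: "(v,w) \<in> E" "g \<in> carrier (G v)" "h \<in> carrier (G w)"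
      "c = free_inj V G v g \<otimes>\<^bsub>free_product V G\<^esub> free_inj V G w h
       \<otimes>\<^bsub>free_product V G\<^esub> inv\<^bsub>free_product V G\<^esub> (free_inj V G v g) \<otimes>\<^bsub>free_product V G\<^esub> inv\<^bsub>free_product V G\<^esub> (free_inj V G w h)"
      unfolding graph_commutators_def by (elim CollectE exE conjE) (rule that, simp_all)
    have vw: "v \<in> V" "w \<in> V" using c E by auto
    have fc: "f v g \<in> carrier H" "f w h \<in> carrier H" using f vw c by (auto simp: hom_def)
    note cl = free_inj_closed[of v V g G, OF vw(1) c(2)] free_inj_closed[of w V h G, OF vw(2) c(3)]
    have "F c = f v g \<otimes>\<^bsub>H\<^esub> f w h \<otimes>\<^bsub>H\<^esub> inv\<^bsub>H\<^esub> f v g \<otimes>\<^bsub>H\<^esub> inv\<^bsub>H\<^esub> f w h"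
      using cl vw c by (simp add: Ff)
    also have "\<dots> = f w h \<otimes>\<^bsub>H\<^esub> f v g \<otimes>\<^bsub>H\<^esub> inv\<^bsub>H\<^esub> f v g \<otimes>\<^bsub>H\<^esub> inv\<^bsub>H\<^esub> f w h"
      by (simp only: comm[OF c(1-3)])
    also have "\<dots> = \<one>\<^bsub>H\<^esub>" using fc by (simp add: H.m_assoc)
    finally show "c \<in> kernel (free_product V G) H F" using cl c(4) by (simp add: kernel_def)
  qed
  then have "?N \<subseteq> kernel (free_product V G) H F"
    unfolding normal_closure_def using gh.normal_kernel by blast
  then have k: "F x = \<one>\<^bsub>H\<^esub>" if "x \<in> ?N" for x using that by (auto simp: kernel_def)
  have N: "?N \<lhd> free_product V G"
    by (intro normal_normal_closure group_free_product graph_commutators_closed assms)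
  interpret N: normal ?N "free_product V G" by (rule N)
  have eq: "F x = F y" if "x \<in> carrier (free_product V G)" "y \<in> carrier (free_product V G)"
    "?N #>\<^bsub>free_product V G\<^esub> x = ?N #>\<^bsub>free_product V G\<^esub> y" for x y
  proof -
    have "x \<in> ?N #>\<^bsub>free_product V G\<^esub> y" using that gh.rcos_self[OF that(1) N.is_subgroup] by simp
    then obtain n where n: "n \<in> ?N" "x = n \<otimes>\<^bsub>free_product V G\<^esub> y" by (auto simp: r_coset_def)
    then show ?thesis using k[OF n(1)] that by (simp add: N.mem_carrier)
  qed
  obtain K where "K \<in> hom (free_product V G Mod ?N) H"
     "\<And>x. x \<in> carrier (free_product V G) \<Longrightarrow> K (?N #>\<^bsub>free_product V G\<^esub> x) = F x"
    using FactGroup_universal[OF F N eq] by metis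
  then show ?thesis
    by (intro bexI[of _ K] ballI) (simp_all add: graph_product_def graph_inj_def free_inj_closed Ff)
qed

lemma graph_product_induct:
  assumes G: "\<And>v. v \<in> V \<Longrightarrow> group (G v)" and E: "E \<subseteq> V \<times> V" and s: "s \<in> carrier (graph_product V E G)"
    and 1: "P \<one>\<^bsub>graph_product V E G\<^esub>"
    and 2: "\<And>v g t. v \<in> V \<Longrightarrow> g \<in> carrier (G v) \<Longrightarrow> t \<in> carrier (graph_product V E G) \<Longrightarrow> P t
      \<Longrightarrow> P (graph_inj V E G v g \<otimes>\<^bsub>graph_product V E G\<^esub> t)"
  shows "P s"
proof -
  let ?N = "normal_closure (free_product V G) (graph_commutators V E G)"
  have N: "?N \<lhd> free_product V G"
    by (intro normal_normal_closure group_free_product graph_commutators_closed assms)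
  interpret N: normal ?N "free_product V G" by (rule N)
  obtain w where w: "w \<in> free_words V G" "s = ?N #>\<^bsub>free_product V G\<^esub> free_class V G w"
    using s by (auto simp: graph_product_def carrier_FactGroup carrier_free)
  have "P (?N #>\<^bsub>free_product V G\<^esub> free_class V G w)" using w(1)
  proof (induction w)
    case Nil
    show ?case using 1 N.coset_mult_one[OF N.subset] by (simp add: graph_product_def one_free[symmetric])
  next
    case (Cons p w)
    obtain v g where p: "p = (v,g)" by force
    have v: "v \<in> V" "g \<in> carrier (G v)" and w: "w \<in> free_words V G"
      using Cons.prems by (auto simp: p free_words_def)
    have "free_class V G w \<in> carrier (free_product V G)" using w by (simp add: carrier_free)
    then show ?case
      using 2[OF v, of "?N #>\<^bsub>free_product V G\<^esub> free_class V G w"] Cons w v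
      by (simp add: p free_class_Cons graph_inj_def graph_product_def carrier_FactGroup N.rcos_sum free_inj_closed)
  qed
  then show ?thesis using w by simp
qed

lemma graph_inj_closed:
  assumes "v \<in> V" "g \<in> carrier (G v)"
  shows "graph_inj V E G v g \<in> carrier (graph_product V E G)"
  by (auto simp: graph_inj_def graph_product_def carrier_FactGroup free_inj_closed assms)

lemma graph_action_ex1:
  assumes G: "\<And>v. v \<in> V \<Longrightarrow> group (G v)" and E: "E \<subseteq> V \<times> V"
    and a: "\<And>v. v \<in> V \<Longrightarrow> homeo_action (G v) X (\<alpha> v)"
    and c: "actions_commute E G X \<alpha>"
  shows "\<exists>!\<beta>. homeo_action (graph_product V E G) X \<beta>
       \<and> \<beta> \<in> extensional (carrier (graph_product V E G))
       \<and> (\<forall>v \<in> V. \<forall>g \<in> carrier (G v). \<beta> (graph_inj V E G v g) = \<alpha> v g)"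
proof -
  let ?P = "graph_product V E G" and ?S = "topspace X"
  have P: "group ?P" by (rule group_graph_product[OF G E])
  interpret P: group ?P by fact
  have B: "group (BijGroup ?S)" by (rule group_BijGroup)
  have h: "\<alpha> v \<in> hom (G v) (BijGroup ?S)" if "v \<in> V" for v
    using a[OF that] by (auto simp: homeo_action_def group_action_def group_hom_def group_hom_axioms_def)
  have bij: "\<alpha> v g \<in> Bij ?S" if "v \<in> V" "g \<in> carrier (G v)" for v g
    using h that by (auto simp: hom_def BijGroup_def)
  have comm: "\<alpha> v g \<otimes>\<^bsub>BijGroup ?S\<^esub> \<alpha> w k = \<alpha> w k \<otimes>\<^bsub>BijGroup ?S\<^esub> \<alpha> v g"
    if "(v,w) \<in> E" "g \<in> carrier (G v)" "k \<in> carrier (G w)" for v w g k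
  proof -
    have "v \<in> V" "w \<in> V" using that E by auto
    then have "\<alpha> v g \<in> Bij ?S" "\<alpha> w k \<in> Bij ?S" using bij that by auto
    moreover have "compose ?S (\<alpha> v g) (\<alpha> w k) = compose ?S (\<alpha> w k) (\<alpha> v g)"
      using c that unfolding actions_commute_def compose_def by (auto simp: fun_eq_iff)
    ultimately show ?thesis by (simp add: BijGroup_def)
  qed
  obtain F where F: "F \<in> hom ?P (BijGroup ?S)"
    "\<And>v g. v \<in> V \<Longrightarrow> g \<in> carrier (G v) \<Longrightarrow> F (graph_inj V E G v g) = \<alpha> v g"
  proof -
    have "\<exists>F \<in> hom ?P (BijGroup ?S). \<forall>v \<in> V. \<forall>g \<in> carrier (G v). F (graph_inj V E G v g) = \<alpha> v g"
      by (rule graph_product_universal) (fact G E B h comm)+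
    then show thesis using that by (elim bexE) simp
  qed
  interpret F: group_hom ?P "BijGroup ?S" F
    by (intro group_hom.intro group_hom_axioms.intro F P B)
  let ?F = "restrict F (carrier ?P)"
  have "homeomorphic_map X X (F s)" if "s \<in> carrier ?P" for s
  proof (rule graph_product_induct[where V=V and G=G and E=E and s=s and P="\<lambda>s. homeomorphic_map X X (F s)"])
    show "s \<in> carrier ?P" by (rule that)
  next
    show "homeomorphic_map X X (F \<one>\<^bsub>?P\<^esub>)"
      unfolding F.hom_one by (rule homeomorphic_map_eq[of _ _ id]) (auto simp: BijGroup_def)
  next
    fix v g t assume *: "v \<in> V" "g \<in> carrier (G v)" "t \<in> carrier ?P" "homeomorphic_map X X (F t)"
    have "homeomorphic_map X X (\<alpha> v g)" using a * by (auto simp: homeo_action_def)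
    then have "homeomorphic_map X X (\<alpha> v g \<circ> F t)" using *(4) homeomorphic_map_compose by blast
    moreover have "F (graph_inj V E G v g \<otimes>\<^bsub>?P\<^esub> t) = compose ?S (\<alpha> v g) (F t)"
      using F.hom_closed[OF *(3)] bij[of v g] * by (simp add: graph_inj_closed F BijGroup_def)
    ultimately show "homeomorphic_map X X (F (graph_inj V E G v g \<otimes>\<^bsub>?P\<^esub> t))"
      by (auto intro: homeomorphic_map_eq simp: compose_def)
  qed (fact G E)+
  moreover have "?F \<in> hom ?P (BijGroup ?S)" using F by (auto simp: hom_def)
  ultimately have "homeo_action ?P X ?F"
    using P B by (auto simp: homeo_action_def group_action_def group_hom_def group_hom_axioms_def)
  moreover have "\<beta> = \<gamma>"
    if "homeo_action ?P X \<beta>" "\<beta> \<in> extensional (carrier ?P)"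
       "homeo_action ?P X \<gamma>" "\<gamma> \<in> extensional (carrier ?P)"
       "\<And>v g. v \<in> V \<Longrightarrow> g \<in> carrier (G v) \<Longrightarrow> \<beta> (graph_inj V E G v g) = \<gamma> (graph_inj V E G v g)" for \<beta> \<gamma>
  proof (rule extensionalityI[OF that(2,4)])
    interpret b: group_hom ?P "BijGroup ?S" \<beta> using that by (auto simp: homeo_action_def group_action_def)
    interpret c: group_hom ?P "BijGroup ?S" \<gamma> using that by (auto simp: homeo_action_def group_action_def)
    fix s assume "s \<in> carrier ?P"
    show "\<beta> s = \<gamma> s"
    proof (rule graph_product_induct[where V=V and G=G and E=E and s=s and P="\<lambda>s. \<beta> s = \<gamma> s"])
      show "s \<in> carrier ?P" by fact
      show "\<beta> \<one>\<^bsub>?P\<^esub> = \<gamma> \<one>\<^bsub>?P\<^esub>" by simp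
      fix v g t assume "v \<in> V" "g \<in> carrier (G v)" "t \<in> carrier ?P" "\<beta> t = \<gamma> t"
      then show "\<beta> (graph_inj V E G v g \<otimes>\<^bsub>?P\<^esub> t) = \<gamma> (graph_inj V E G v g \<otimes>\<^bsub>?P\<^esub> t)"
        by (simp add: graph_inj_closed that(5))
    qed (fact G E)+
  qed
  ultimately show ?thesis
    by (intro ex1I[of _ ?F]) (auto simp: F graph_inj_closed)
qed

end

theory Submission
  imports Defs "HOL-Library.Sublist"
begin

text \<open>
  Write \<open>h\<close> for the graph product of the multipliers. Positive definiteness says that for each point \<open>x\<close> the
  kernel \<open>K\<^sub>x(s, t) = h(s\<inverse>t, t\<inverse>x)\<close> on the graph product group is positive on every finite set of
  elements. Each finite set lies in a product set \<open>G v\<^sub>1 \<cdots> G v\<^sub>n\<close>, and the proof is an induction on \<open>n\<close>, for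
  all \<open>x\<close> at once.

  For the step, fix a vertex \<open>v\<close> and let \<open>L\<close> be the subgroup generated by the vertex groups adjacent to
  \<open>v\<close>. An element of \<open>G v\<close> times a product set \<open>T\<close> can be written as \<open>g c p\<close> with \<open>g \<in> G v\<close>, \<open>c \<in> L\<close>, such that
  no reduced expression of \<open>p\<close> starts with a letter of \<open>v\<close> or of a neighbour of \<open>v\<close>, and such that \<open>c\<close> and
  \<open>c p\<close> lie in \<open>T\<close> (\<open>amalgam_decomposition\<close>). If \<open>s = g c p\<close> and \<open>t = k d q\<close> with \<open>g \<noteq> k\<close>, then
  \<open>s\<inverse>t = p\<inverse> (c\<inverse>d) (g\<inverse>k) q\<close>, and a reduced expression is obtained by simply concatenating reduced
  expressions of the four factors, so that \<open>h(s\<inverse>t, t\<inverse>x)\<close> is a product of four values. The commutation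
  hypotheses remove the dependence of the middle factors on the letters of the other side. Put
  \<open>b(s) = h(p, s\<inverse>x)\<close> and \<open>b(t) = h(q, t\<inverse>x)\<close>, let \<open>K\<^sup>v\<close> be the kernel of the vertex \<open>v\<close>, write a star for
  complex conjugation, and let \<open>y = g\<inverse>x\<close>. Then for all \<open>s\<close> and \<open>t\<close>, where the bracket is \<open>1\<close> or \<open>0\<close>,

    \<open>K\<^sub>x(s, t) = b(s)\<^sup>* K\<^sup>v\<^sub>x(g, k) K\<^sub>x(c, d) b(t) + [g = k] (K\<^sub>y(c p, d q) - b(s)\<^sup>* K\<^sub>y(c, d) b(t))\<close>.

  In terms of vectors \<open>e\<^sub>s\<close> with Gram matrix \<open>K\<close>, the vector \<open>e\<^bsub>cp\<^esub>\<close> is split into its projection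
  \<open>b(s) e\<^sub>c\<close> to the span of the \<open>e\<^sub>d\<close> with \<open>d \<in> L\<close> and an orthogonal rest. The group \<open>G v\<close> acts on the
  projections as on a tensor product, and it moves the rests to mutually orthogonal places. So the first
  summand is positive by the Schur product theorem (\<open>psd_on_times\<close>) and the second one because a Gram
  matrix minus that of the projections is positive (\<open>pos_kernel_difference\<close>); both use the
  induction hypothesis on \<open>T\<close>. This is carried out in \<open>ker_across\<close>, \<open>ker_link_left\<close> and
  \<open>pos_kernel_ker_step\<close>.

  All this needs that the product of values along a reduced word depends only on the group element. By the
  hypotheses it is invariant under exchanging neighbouring letters of adjacent vertices, and reduced words of
  the same element differ by such exchanges (\<open>normal_form\<close>). The latter is shown by letting the graph product
  act on classes of reduced words by left multiplication: the element of a reduced word \<open>w\<close> sends the class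
  of the empty word to the class of \<open>w\<close>. Continuity in \<open>x\<close> is clear from the product formula for a fixed
  reduced word.
\<close>

section \<open>Positive kernels\<close>

definition psd_on :: "'i set \<Rightarrow> ('i \<Rightarrow> 'i \<Rightarrow> complex) \<Rightarrow> bool" where
  "psd_on I A \<longleftrightarrow> (\<forall>c. (\<Sum>i\<in>I. \<Sum>j\<in>I. cnj (c i) * A i j * c j) \<in> \<real>\<^sub>\<ge>\<^sub>0)"

text \<open>Testing on finite subsets gives the same as testing on finite families with repetitions, by
  \<open>pos_kernel_pullback\<close> below.\<close>

definition pos_kernel :: "'i set \<Rightarrow> ('i \<Rightarrow> 'i \<Rightarrow> complex) \<Rightarrow> bool" where
  "pos_kernel S K \<longleftrightarrow> (\<forall>F. finite F \<longrightarrow> F \<subseteq> S \<longrightarrow> psd_on F K)"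

lemma psd_on_cong:
  assumes "\<And>i j. i \<in> I \<Longrightarrow> j \<in> I \<Longrightarrow> A i j = B i j"
  shows "psd_on I A \<longleftrightarrow> psd_on I B"
  unfolding psd_on_def using assms by (simp cong: sum.cong)

lemma psd_on_mono:
  assumes "psd_on I A" "finite I" "J \<subseteq> I"
  shows "psd_on J A"
  unfolding psd_on_def
proof
  fix c :: "_ \<Rightarrow> complex"
  define d where "d i = (if i \<in> J then c i else 0)" for i
  have "(\<Sum>i\<in>J. \<Sum>j\<in>J. cnj (c i) * A i j * c j) = (\<Sum>i\<in>J. \<Sum>j\<in>J. cnj (d i) * A i j * d j)"
    by (intro sum.cong refl) (simp add: d_def)
  also have "\<dots> = (\<Sum>i\<in>J. \<Sum>j\<in>I. cnj (d i) * A i j * d j)"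
    by (intro sum.cong refl sum.mono_neutral_left) (use assms in \<open>auto simp: d_def\<close>)
  also have "\<dots> = (\<Sum>i\<in>I. \<Sum>j\<in>I. cnj (d i) * A i j * d j)"
    by (intro sum.mono_neutral_left) (use assms in \<open>auto simp: d_def\<close>)
  finally show "(\<Sum>i\<in>J. \<Sum>j\<in>J. cnj (c i) * A i j * c j) \<in> \<real>\<^sub>\<ge>\<^sub>0"
    using assms(1)[unfolded psd_on_def, rule_format, of d] by (simp only:)
qed

lemma psd_on_diag:
  assumes "psd_on I A" "finite I" "i \<in> I"
  shows "Re (A i i) \<ge> 0" "Im (A i i) = 0"
proof -
  have "psd_on {i} A" by (rule psd_on_mono[OF assms(1,2)]) (use assms in simp)
  then have "A i i \<in> \<real>\<^sub>\<ge>\<^sub>0"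
    unfolding psd_on_def by (elim allE[of _ "\<lambda>_. 1"]) simp
  then show "Re (A i i) \<ge> 0" "Im (A i i) = 0" by (simp_all add: complex_nonneg_Reals_iff)
qed

lemma psd_on_pair:
  assumes "psd_on I A" "finite I" "i \<in> I" "j \<in> I" "i \<noteq> j"
  shows "cnj a * A i i * a + cnj a * A i j * b + cnj b * A j i * a + cnj b * A j j * b \<in> \<real>\<^sub>\<ge>\<^sub>0"
proof -
  have "psd_on {i,j} A" by (rule psd_on_mono[OF assms(1,2)]) (use assms in simp)
  from this[unfolded psd_on_def, rule_format, of "\<lambda>k. if k = i then a else b"]
  show ?thesis using assms(5) by (simp add: add.assoc)
qed

lemma psd_on_hermitian:
  assumes "psd_on I A" "finite I" "i \<in> I" "j \<in> I"
  shows "A j i = cnj (A i j)"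
proof (cases "i = j")
  case True
  then show ?thesis using psd_on_diag[OF assms(1-3)] by (simp add: complex_eq_iff)
next
  case False
  note d = psd_on_diag[OF assms(1,2,3)] psd_on_diag[OF assms(1,2,4)]
  have "Im (A i j) + Im (A j i) = 0"
    using psd_on_pair[OF assms False, of 1 1] d by (simp add: complex_nonneg_Reals_iff)
  moreover have "Re (A i j) - Re (A j i) = 0"
    using psd_on_pair[OF assms False, of 1 \<i>] d by (simp add: complex_nonneg_Reals_iff)
  ultimately show ?thesis by (simp add: complex_eq_iff)
qed

text \<open>If \<open>A i i\<close> vanishes, the form evaluated at \<open>- t (A i j) e\<^sub>i + e\<^sub>j\<close> is affine in \<open>t\<close> with slope
  \<open>- 2 |A i j|\<^sup>2\<close>, so it can only stay nonnegative if this slope is zero.\<close>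

lemma psd_on_zero_diag:
  assumes "psd_on I A" "finite I" "i \<in> I" "j \<in> I" "A i i = 0"
  shows "A i j = 0"
proof (rule ccontr)
  assume n: "A i j \<noteq> 0"
  then have ij: "i \<noteq> j" using assms(5) by blast
  define z where "z = A i j"
  have zz: "z \<noteq> 0" using n by (simp add: z_def)
  have h: "A j i = cnj z" using psd_on_hermitian[OF assms(1-4)] by (simp add: z_def)
  define r where "r = Re (A j j)"
  have pos: "0 \<le> - 2 * t * (cmod z)\<^sup>2 + r" for t :: real
  proof -
    have 1: "- (t * (z * cnj z)) - t * (cnj z * z) + A j j \<in> \<real>\<^sub>\<ge>\<^sub>0"
      using psd_on_pair[OF assms(1-4) ij, of "- of_real t * z" 1] assms(5) h
      by (simp add: z_def[symmetric])
    have 2: "z * cnj z = of_real ((cmod z)\<^sup>2)" "cnj z * z = of_real ((cmod z)\<^sup>2)"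
      by (simp_all only: complex_norm_square mult.commute[of "cnj z"])
    show ?thesis using 1 unfolding 2 by (simp add: complex_nonneg_Reals_iff r_def)
  qed
  have "(cmod z)\<^sup>2 > 0" using zz by simp
  then have "- 2 * ((r + 1) / (cmod z)\<^sup>2) * (cmod z)\<^sup>2 + r = - r - 2" by simp
  then show False using pos[of "(r + 1) / (cmod z)\<^sup>2"] pos[of 0] by simp
qed

lemma psd_on_add:
  assumes "psd_on I A" "psd_on I B"
  shows "psd_on I (\<lambda>i j. A i j + B i j)"
  using assms unfolding psd_on_def by (simp add: algebra_simps sum.distrib)

lemma psd_on_scale:
  assumes "psd_on I A"
  shows "psd_on I (\<lambda>i j. cnj (b i) * A i j * b j)"
  unfolding psd_on_def
proof
  fix c
  show "(\<Sum>i\<in>I. \<Sum>j\<in>I. cnj (c i) * (cnj (b i) * A i j * b j) * c j) \<in> \<real>\<^sub>\<ge>\<^sub>0"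
    using assms[unfolded psd_on_def, rule_format, of "\<lambda>i. b i * c i"] by (simp add: mult_ac)
qed

text \<open>Given coefficients on \<open>I\<close>, the coefficient at \<open>k\<close> is chosen to minimise the form; the minimum is the form
  of the Schur complement.\<close>

lemma psd_on_schur_complement:
  assumes A: "psd_on (insert k I) A" and fin: "finite I" and k: "k \<notin> I" "A k k \<noteq> 0"
  shows "psd_on I (\<lambda>i j. A i j - A i k * A k j / A k k)"
  unfolding psd_on_def
proof
  fix c :: "_ \<Rightarrow> complex"
  define a where "a = A k k"
  define s where "s = (\<Sum>j\<in>I. A k j * c j)"
  \<comment> \<open>the minimiser of the form in the coordinate \<open>k\<close>\<close>
  define d where "d = c(k := - s / a)"
  have herm: "A j i = cnj (A i j)" if "i \<in> insert k I" "j \<in> insert k I" for i j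
    using psd_on_hermitian[OF A _ that] fin by simp
  have ca: "cnj a = a" using herm[of k k] by (simp add: a_def)
  have a0: "a \<noteq> 0" using k by (simp add: a_def)
  have dI: "d i = c i" if "i \<in> I" for i using that k by (auto simp: d_def)
  have dk: "d k = - s / a" by (simp add: d_def)
  have cs: "cnj s = (\<Sum>i\<in>I. cnj (c i) * A i k)"
    unfolding s_def cnj_sum by (intro sum.cong refl) (use herm[of k] in \<open>simp add: mult.commute\<close>)
  have 1: "(\<Sum>i\<in>I. \<Sum>j\<in>I. cnj (c i) * (A i k * A k j / a) * c j) = cnj s * s / a"
    unfolding cs by (simp add: s_def sum_product sum_divide_distrib mult_ac, rule sum.swap)
  define Q where "Q = (\<Sum>i\<in>I. \<Sum>j\<in>I. cnj (c i) * A i j * c j)"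
  have row: "(\<Sum>j\<in>I. cnj (d k) * A k j * d j) = cnj (d k) * s"
    unfolding s_def sum_distrib_left by (intro sum.cong refl) (simp add: dI mult_ac)
  have col: "(\<Sum>i\<in>I. cnj (d i) * A i k * d k) = cnj s * d k"
    unfolding cs sum_distrib_right by (intro sum.cong refl) (simp add: dI)
  have q: "(\<Sum>i\<in>I. \<Sum>j\<in>I. cnj (d i) * A i j * d j) = Q"
    unfolding Q_def by (intro sum.cong refl) (simp add: dI)
  have "(\<Sum>i\<in>insert k I. \<Sum>j\<in>insert k I. cnj (d i) * A i j * d j)
      = cnj (d k) * a * d k + cnj (d k) * s + (cnj s * d k + Q)"
    using fin k by (simp add: sum.distrib row col q a_def)
  also have "\<dots> = Q - cnj s * s / a"
    using a0 ca by (simp add: dk field_simps)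
  also have "\<dots> = (\<Sum>i\<in>I. \<Sum>j\<in>I. cnj (c i) * (A i j - A i k * A k j / A k k) * c j)"
    unfolding 1[symmetric] Q_def a_def[symmetric] sum_subtractf[symmetric]
    by (intro sum.cong refl) (simp add: algebra_simps)
  finally show "(\<Sum>i\<in>I. \<Sum>j\<in>I. cnj (c i) * (A i j - A i k * A k j / A k k) * c j) \<in> \<real>\<^sub>\<ge>\<^sub>0"
    using A[unfolded psd_on_def, rule_format, of d] by (simp only:)
qed

lemma psd_on_extend_zero:
  assumes "psd_on I A" "finite I" "\<And>j. j \<in> insert k I \<Longrightarrow> A k j = 0 \<and> A j k = 0"
  shows "psd_on (insert k I) A"
proof (cases "k \<in> I")
  case False
  then show ?thesis using assms unfolding psd_on_def by simp
qed (use assms in \<open>simp add: insert_absorb\<close>)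

text \<open>The Schur product theorem. Splitting off the rank one matrix of the row of \<open>k\<close> leaves the Schur
  complement, which vanishes on that row and so falls under the induction hypothesis; the product of \<open>B\<close> with
  a rank one matrix is a rescaling of \<open>B\<close>.\<close>

lemma psd_on_times:
  assumes "finite I" "psd_on I A" "psd_on I B"
  shows "psd_on I (\<lambda>i j. A i j * B i j)"
  using assms
proof (induction I arbitrary: A rule: finite_induct)
  case empty
  then show ?case by (simp add: psd_on_def)
next
  case (insert k I)
  note fin = finite.insertI[OF insert.hyps(1), of k]
  have BI: "psd_on I B" using psd_on_mono[OF insert.prems(2) fin] by blast
  have herm: "A j i = cnj (A i j)" if "i \<in> insert k I" "j \<in> insert k I" for i j
    using psd_on_hermitian[OF insert.prems(1) fin that] .
  show ?case
  proof (cases "A k k = 0")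
    case True
    have "A k j = 0 \<and> A j k = 0" if "j \<in> insert k I" for j
      using psd_on_zero_diag[OF insert.prems(1) fin _ that True] herm[of k j] that by simp
    then show ?thesis
      using insert.IH[OF psd_on_mono[OF insert.prems(1) fin] BI] insert.hyps
      by (intro psd_on_extend_zero) auto
  next
    case False
    define a where "a = A k k"
    define C where "C i j = A i j - A i k * A k j / A k k" for i j
    have 1: "psd_on I C"
      unfolding C_def by (rule psd_on_schur_complement[OF insert.prems(1) insert.hyps False])
    have 2: "psd_on (insert k I) (\<lambda>i j. C i j * B i j)"
      using insert.IH[OF 1 BI] insert.hyps False by (intro psd_on_extend_zero) (auto simp: C_def)
    have "Im a = 0" "Re a \<ge> 0" "a \<noteq> 0"
      using psd_on_diag[OF insert.prems(1) fin, of k] False by (auto simp: a_def)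
    then obtain r where r: "a = of_real r" "r > 0"
      by (metis complex_is_Real_iff Re_complex_of_real of_real_0 order_le_less of_real_Re)
    define b where "b j = A k j / of_real (sqrt r)" for j
    have 3: "A i k * A k j / A k k = cnj (b i) * b j" if "i \<in> insert k I" for i j
      using herm[of k i] that r
      by (simp add: b_def a_def[symmetric] flip: of_real_mult)
    have "psd_on (insert k I) (\<lambda>i j. C i j * B i j + cnj (b i) * B i j * b j)"
      by (intro psd_on_add 2 psd_on_scale insert.prems)
    also have "?this \<longleftrightarrow> ?thesis"
      by (rule psd_on_cong) (simp add: C_def 3 algebra_simps)
    finally show ?thesis .
  qed
qed

lemma pos_kernel_cong:
  assumes "\<And>i j. i \<in> S \<Longrightarrow> j \<in> S \<Longrightarrow> A i j = B i j"
  shows "pos_kernel S A \<longleftrightarrow> pos_kernel S B"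
proof -
  have "psd_on F A \<longleftrightarrow> psd_on F B" if "F \<subseteq> S" for F
    by (rule psd_on_cong) (use assms that in blast)
  then show ?thesis unfolding pos_kernel_def by blast
qed

lemma pos_kernel_times:
  "pos_kernel S A \<Longrightarrow> pos_kernel S B \<Longrightarrow> pos_kernel S (\<lambda>i j. A i j * B i j)"
  by (simp add: pos_kernel_def psd_on_times)

lemma pos_kernel_add:
  "pos_kernel S A \<Longrightarrow> pos_kernel S B \<Longrightarrow> pos_kernel S (\<lambda>i j. A i j + B i j)"
  by (simp add: pos_kernel_def psd_on_add)

lemma pos_kernel_scale: "pos_kernel S A \<Longrightarrow> pos_kernel S (\<lambda>i j. cnj (b i) * A i j * b j)"
  by (simp add: pos_kernel_def psd_on_scale)

lemma pos_kernel_hermitian: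
  assumes "pos_kernel S K" "i \<in> S" "j \<in> S"
  shows "K j i = cnj (K i j)"
  using assms psd_on_hermitian[of "{i,j}" K i j] by (simp add: pos_kernel_def)

text \<open>Indices with the same image are merged by adding up their coefficients, so \<open>f\<close> may be
  arbitrary.\<close>

lemma pos_kernel_pullback:
  assumes K: "pos_kernel S K" and f: "\<And>i. i \<in> I \<Longrightarrow> f i \<in> S"
  shows "pos_kernel I (\<lambda>i j. K (f i) (f j))"
  unfolding pos_kernel_def psd_on_def
proof (intro allI impI)
  fix F and c :: "_ \<Rightarrow> complex"
  assume F: "finite F" "F \<subseteq> I"
  define d where "d s = (\<Sum>i \<in> {i \<in> F. f i = s}. c i)" for s
  have "(\<Sum>i\<in>F. \<Sum>j\<in>F. cnj (c i) * K (f i) (f j) * c j)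
      = (\<Sum>s\<in>f`F. \<Sum>i \<in> {i \<in> F. f i = s}. \<Sum>t\<in>f`F. \<Sum>j \<in> {j \<in> F. f j = t}. cnj (c i) * K (f i) (f j) * c j)"
    by (subst sum.image_gen[OF F(1), of _ f], intro sum.cong refl, subst sum.image_gen[OF F(1), of _ f], rule refl)
  also have "\<dots> = (\<Sum>s\<in>f`F. \<Sum>i \<in> {i \<in> F. f i = s}. \<Sum>t\<in>f`F. \<Sum>j \<in> {j \<in> F. f j = t}. cnj (c i) * K s t * c j)"
    by (intro sum.cong refl) auto
  also have "\<dots> = (\<Sum>s\<in>f`F. \<Sum>t\<in>f`F. cnj (d s) * K s t * d t)"
    unfolding d_def cnj_sum
    by (intro sum.cong refl, subst sum.swap, intro sum.cong refl)
       (simp add: sum_distrib_left sum_distrib_right, rule sum.swap)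
  finally show "(\<Sum>i\<in>F. \<Sum>j\<in>F. cnj (c i) * K (f i) (f j) * c j) \<in> \<real>\<^sub>\<ge>\<^sub>0"
    using K[unfolded pos_kernel_def psd_on_def, rule_format, of "f ` F" d] F f by (auto simp only:)
qed

lemma sum_nonneg_Reals:
  fixes f :: "'i \<Rightarrow> complex"
  assumes "\<And>i. i \<in> I \<Longrightarrow> f i \<in> \<real>\<^sub>\<ge>\<^sub>0"
  shows "sum f I \<in> \<real>\<^sub>\<ge>\<^sub>0"
  using assms by (induction I rule: infinite_finite_induct) auto

lemma pos_kernel_blocks:
  assumes "\<And>b. pos_kernel {i \<in> S. g i = b} K"
  shows "pos_kernel S (\<lambda>i j. if g i = g j then K i j else 0)"
  unfolding pos_kernel_def psd_on_def
proof (intro allI impI)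
  fix F and c :: "_ \<Rightarrow> complex"
  assume F: "finite F" "F \<subseteq> S"
  let ?B = "\<lambda>b. {i \<in> F. g i = b}"
  have "(\<Sum>i\<in>F. \<Sum>j\<in>F. cnj (c i) * (if g i = g j then K i j else 0) * c j)
      = (\<Sum>b\<in>g`F. \<Sum>i\<in>?B b. \<Sum>j\<in>F. cnj (c i) * (if g i = g j then K i j else 0) * c j)"
    by (rule sum.image_gen[OF F(1)])
  also have "\<dots> = (\<Sum>b\<in>g`F. \<Sum>i\<in>?B b. \<Sum>j\<in>?B b. cnj (c i) * K i j * c j)"
    by (intro sum.cong refl sum.mono_neutral_cong_right) (use F in auto)
  also have "\<dots> \<in> \<real>\<^sub>\<ge>\<^sub>0"
  proof (rule sum_nonneg_Reals)
    fix b
    have "finite (?B b)" "?B b \<subseteq> {i \<in> S. g i = b}" using F by auto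
    then show "(\<Sum>i\<in>?B b. \<Sum>j\<in>?B b. cnj (c i) * K i j * c j) \<in> \<real>\<^sub>\<ge>\<^sub>0"
      using assms[of b] unfolding pos_kernel_def psd_on_def by blast
  qed
  finally show "(\<Sum>i\<in>F. \<Sum>j\<in>F. cnj (c i) * (if g i = g j then K i j else 0) * c j) \<in> \<real>\<^sub>\<ge>\<^sub>0" .
qed

text \<open>For vectors \<open>e\<^sub>s\<close> with Gram matrix \<open>K\<close> the hypothesis says that \<open>e\<^bsub>f j\<^esub> - b\<^sub>j e\<^bsub>g j\<^esub>\<close> is orthogonal to all
  \<open>e\<^bsub>g i\<^esub>\<close>, and the new kernel is the Gram matrix of these differences.\<close>

lemma pos_kernel_difference:
  assumes K: "pos_kernel S K" and f: "\<And>i. i \<in> I \<Longrightarrow> f i \<in> S" and g: "\<And>i. i \<in> I \<Longrightarrow> g i \<in> S"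
    and gf: "\<And>i j. i \<in> I \<Longrightarrow> j \<in> I \<Longrightarrow> K (g i) (f j) = K (g i) (g j) * b j"
  shows "pos_kernel I (\<lambda>i j. K (f i) (f j) - cnj (b i) * K (g i) (g j) * b j)"
proof -
  \<comment> \<open>the vectors of \<open>f\<close> and \<open>g\<close> as one family, so that a difference becomes a choice of coefficients\<close>
  define e where "e = (\<lambda>(i, u). if u then f i else g i)"
  have e: "pos_kernel (I \<times> UNIV) (\<lambda>p q. K (e p) (e q))"
    by (rule pos_kernel_pullback[OF K]) (auto simp: e_def f g)
  show ?thesis
    unfolding pos_kernel_def psd_on_def
  proof (intro allI impI)
    fix F and c :: "_ \<Rightarrow> complex"
    assume F: "finite F" "F \<subseteq> I"
    define d where "d = (\<lambda>(i, u). if u then c i else - b i * c i)"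
    have fg: "K (f i) (g j) = cnj (b i) * K (g i) (g j)" if "i \<in> I" "j \<in> I" for i j
    proof -
      have "K (f i) (g j) = cnj (K (g j) (f i))"
        by (rule pos_kernel_hermitian[OF K]) (simp_all add: f g that)
      also have "\<dots> = cnj (K (g j) (g i)) * cnj (b i)" by (simp add: gf that)
      also have "cnj (K (g j) (g i)) = K (g i) (g j)"
        by (rule pos_kernel_hermitian[OF K, symmetric]) (simp_all add: g that)
      finally show ?thesis by (simp add: mult.commute)
    qed
    have U: "(\<Sum>u\<in>(UNIV::bool set). r u) = r True + r False" for r :: "bool \<Rightarrow> complex"
      by (simp add: UNIV_bool add.commute)
    have "(\<Sum>p\<in>F\<times>UNIV. \<Sum>q\<in>F\<times>UNIV. cnj (d p) * K (e p) (e q) * d q)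
       = (\<Sum>i\<in>F. \<Sum>u\<in>UNIV. \<Sum>j\<in>F. \<Sum>v\<in>UNIV. cnj (d (i,u)) * K (e (i,u)) (e (j,v)) * d (j,v))"
      by (simp add: sum.cartesian_product')
    also have "\<dots> = (\<Sum>i\<in>F. \<Sum>j\<in>F. cnj (c i) * (K (f i) (f j) - cnj (b i) * K (g i) (g j) * b j) * c j)"
      unfolding U sum.distrib[symmetric]
    proof (intro sum.cong refl)
      fix i j assume "i \<in> F" "j \<in> F"
      then have ij: "i \<in> I" "j \<in> I" using F by auto
      show "cnj (d (i, True)) * K (e (i, True)) (e (j, True)) * d (j, True) +
            cnj (d (i, True)) * K (e (i, True)) (e (j, False)) * d (j, False) +
           (cnj (d (i, False)) * K (e (i, False)) (e (j, True)) * d (j, True) +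
            cnj (d (i, False)) * K (e (i, False)) (e (j, False)) * d (j, False)) =
           cnj (c i) * (K (f i) (f j) - cnj (b i) * K (g i) (g j) * b j) * c j"
        by (simp add: d_def e_def fg[OF ij] gf[OF ij] algebra_simps)
    qed
    finally show "(\<Sum>i\<in>F. \<Sum>j\<in>F. cnj (c i) * (K (f i) (f j) - cnj (b i) * K (g i) (g j) * b j) * c j) \<in> \<real>\<^sub>\<ge>\<^sub>0"
      using e[unfolded pos_kernel_def psd_on_def, rule_format, of "F \<times> UNIV" d] F by auto
  qed
qed

lemma pos_kernel_psd_matrix:
  assumes "pos_kernel S K" "\<And>i. i < n \<Longrightarrow> f i \<in> S"
  shows "psd_matrix n (\<lambda>i j. K (f i) (f j))"
  using pos_kernel_pullback[of S K "{..<n}" f] assms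
  by (auto simp: pos_kernel_def psd_on_def psd_matrix_def)

lemma pos_kernelI_psd_matrix:
  assumes "\<And>n f. (\<And>i. i < n \<Longrightarrow> f i \<in> S) \<Longrightarrow> psd_matrix n (\<lambda>i j. K (f i) (f j))"
  shows "pos_kernel S K"
  unfolding pos_kernel_def psd_on_def
proof (intro allI impI)
  fix F and c :: "_ \<Rightarrow> complex"
  assume F: "finite F" "F \<subseteq> S"
  obtain f where f: "bij_betw f {..<card F} F"
    using ex_bij_betw_nat_finite[OF F(1)] by (auto simp: atLeast0LessThan)
  have "f i \<in> S" if "i < card F" for i using f F(2) that by (auto simp: bij_betw_def)
  then have "(\<Sum>i<card F. \<Sum>j<card F. cnj (c (f i)) * K (f i) (f j) * c (f j)) \<in> \<real>\<^sub>\<ge>\<^sub>0"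
    using assms[of "card F" f] unfolding psd_matrix_def by (elim meta_impE allE[of _ "\<lambda>i. c (f i)"]) auto
  also have "(\<Sum>i<card F. \<Sum>j<card F. cnj (c (f i)) * K (f i) (f j) * c (f j))
      = (\<Sum>i<card F. \<Sum>j\<in>F. cnj (c (f i)) * K (f i) j * c j)"
    by (intro sum.cong refl sum.reindex_bij_betw[OF f])
  also have "\<dots> = (\<Sum>i\<in>F. \<Sum>j\<in>F. cnj (c i) * K i j * c j)"
    by (rule sum.reindex_bij_betw[OF f])
  finally show "(\<Sum>i\<in>F. \<Sum>j\<in>F. cnj (c i) * K i j * c j) \<in> \<real>\<^sub>\<ge>\<^sub>0" .
qed

section \<open>Words in the vertices and exchanges of commuting letters\<close>

text \<open>The vertex \<open>v\<close> occurs in the word, and all letters before its first occurrence commute with it. So the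
  occurrence can be moved to the front.\<close>

fun initial :: "('v \<times> 'v) set \<Rightarrow> 'v \<Rightarrow> 'v list \<Rightarrow> bool" where
  "initial E v [] \<longleftrightarrow> False"
| "initial E v (x # xs) \<longleftrightarrow> x = v \<or> (v, x) \<in> E \<and> initial E v xs"

lemma initial_append:
  "initial E v (xs @ ys) \<longleftrightarrow> initial E v xs \<or> (\<forall>x\<in>set xs. (v, x) \<in> E) \<and> initial E v ys"
  by (induction xs) auto

lemma initial_in_set: "initial E v xs \<Longrightarrow> v \<in> set xs"
  by (induction xs) auto

lemma initial_iff_nth:
  "initial E v xs \<longleftrightarrow> (\<exists>l<length xs. xs ! l = v \<and> (\<forall>p<l. (v, xs ! p) \<in> E))"
proof (induction xs)
  case (Cons x xs)
  show ?case by (auto simp: Cons Ex_less_Suc2 All_less_Suc2)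
qed simp

lemma reduced_word_Nil: "reduced_word E []"
  by (simp add: reduced_word_def)

lemma reduced_word_Cons:
  "reduced_word E (x # xs) \<longleftrightarrow> reduced_word E xs \<and> \<not> initial E x xs"
proof -
  have "reduced_word E (x # xs) \<longleftrightarrow>
    (\<forall>l<length (x # xs). \<forall>k<l. (x # xs) ! k = (x # xs) ! l
       \<longrightarrow> (\<exists>p<l. k < p \<and> ((x # xs) ! k, (x # xs) ! p) \<notin> E))"
    unfolding reduced_word_def by blast
  also have "\<dots> \<longleftrightarrow> (\<forall>l<length xs. \<forall>k<Suc l. (x # xs) ! k = xs ! l
       \<longrightarrow> (\<exists>p<l. k < Suc p \<and> ((x # xs) ! k, xs ! p) \<notin> E))"
    by (simp add: All_less_Suc2 Ex_less_Suc2)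
  also have "\<dots> \<longleftrightarrow> reduced_word E xs \<and> \<not> initial E x xs"
    unfolding reduced_word_def initial_iff_nth by (simp add: All_less_Suc2) blast
  finally show ?thesis .
qed

text \<open>If two equal letters with one in \<open>xs\<close> and one in \<open>ys\<close> have only commuting letters between them, then the
  first one can be moved to the end of \<open>xs\<close> and the second one to the front of \<open>ys\<close>.\<close>

lemma reduced_word_append:
  assumes "reduced_word E xs" "reduced_word E ys"
    and "\<And>x. initial E x (rev xs) \<Longrightarrow> \<not> initial E x ys"
  shows "reduced_word E (xs @ ys)"
  using assms
proof (induction xs)
  case (Cons x xs)
  have 1: "reduced_word E (xs @ ys)"
    using Cons by (auto simp: reduced_word_Cons initial_append)
  have "\<not> initial E x (xs @ ys)"
    using Cons.prems(1) Cons.prems(3)[of x] by (auto simp: reduced_word_Cons initial_append)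
  with 1 show ?case by (simp add: reduced_word_Cons)
qed simp

lemma reduced_word_rev: "reduced_word E xs \<Longrightarrow> reduced_word E (rev xs)"
proof (induction xs)
  case (Cons x xs)
  then show ?case
    by (auto simp: reduced_word_Cons reduced_word_Nil intro!: reduced_word_append)
qed simp

text \<open>Closing the exchange of the first two letters under \<open>Cons\<close> allows exchanges at any place.\<close>

inductive shuffle :: "('v \<times> 'v) set \<Rightarrow> ('v \<times> 'g) list \<Rightarrow> ('v \<times> 'g) list \<Rightarrow> bool" for E where
  shuffle_refl: "shuffle E w w"
| shuffle_swap: "(fst a, fst b) \<in> E \<Longrightarrow> shuffle E (a # b # w) (b # a # w)"
| shuffle_Cons: "shuffle E u w \<Longrightarrow> shuffle E (a # u) (a # w)"
| shuffle_trans: "shuffle E u w \<Longrightarrow> shuffle E w z \<Longrightarrow> shuffle E u z"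

lemma shuffle_sym: "shuffle E u w \<Longrightarrow> sym E \<Longrightarrow> shuffle E w u"
  by (induction rule: shuffle.induct) (auto intro: shuffle.intros dest: symD)

lemma shuffle_set: "shuffle E u w \<Longrightarrow> set u = set w"
  by (induction rule: shuffle.induct) auto

lemma shuffle_append1: "shuffle E u w \<Longrightarrow> shuffle E (u @ z) (w @ z)"
  by (induction rule: shuffle.induct) (auto intro: shuffle.intros)

lemma shuffle_append2: "shuffle E u w \<Longrightarrow> shuffle E (z @ u) (z @ w)"
  by (induction z) (auto intro: shuffle.intros)

lemma shuffle_move:
  "(\<And>b. b \<in> set w \<Longrightarrow> (fst b, fst a) \<in> E) \<Longrightarrow> shuffle E (w @ [a]) (a # w)"
proof (induction w)
  case (Cons b w)
  have "shuffle E (b # w @ [a]) (b # a # w)" using Cons by (auto intro: shuffle_Cons)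
  moreover have "shuffle E (b # a # w) (a # b # w)" using Cons.prems[of b] by (auto intro: shuffle_swap)
  ultimately show ?case by (simp add: shuffle_trans)
qed (simp add: shuffle_refl)

lemma shuffle_initial:
  "shuffle E u w \<Longrightarrow> sym E \<Longrightarrow> initial E v (map fst u) = initial E v (map fst w)"
  by (induction rule: shuffle.induct) (auto dest: symD)

lemma shuffle_reduced_word:
  "shuffle E u w \<Longrightarrow> sym E \<Longrightarrow> irrefl E \<Longrightarrow> reduced_word E (map fst u) = reduced_word E (map fst w)"
proof (induction rule: shuffle.induct)
  case (shuffle_swap a b w)
  then have "fst a \<noteq> fst b" by (auto simp: irrefl_def)
  then show ?case using shuffle_swap by (auto simp: reduced_word_Cons dest: symD)
next
  case (shuffle_Cons u w a)
  then show ?case using shuffle_initial[of E u w "fst a"] by (auto simp: reduced_word_Cons)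
qed auto

text \<open>The letters collected in \<open>c\<close> are those over \<open>D\<close> that can be moved in front of all letters outside
  \<open>c\<close>. Reading the word from the left, a letter once put into \<open>p\<close> stays there, which makes \<open>c\<close> a
  subsequence of \<open>w\<close>.\<close>

lemma ex_split_commuting_prefix:
  assumes sym: "sym E" and D: "\<And>x. x \<in> D \<Longrightarrow> (x, x) \<notin> E"
  shows "\<exists>c p. shuffle E w (c @ p) \<and> subseq c w \<and> fst ` set c \<subseteq> D
     \<and> (\<forall>x\<in>D. \<not> initial E x (map fst p))"
proof (induction w rule: rev_induct)
  case Nil
  then show ?case by (intro exI[of _ "[]"]) (auto intro: shuffle_refl)
next
  case (snoc a w)
  then obtain c p where cp: "shuffle E w (c @ p)" "subseq c w" "fst ` set c \<subseteq> D"
    "\<And>x. x \<in> D \<Longrightarrow> \<not> initial E x (map fst p)" by auto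
  have 1: "shuffle E (w @ [a]) (c @ p @ [a])" using shuffle_append1[OF cp(1), of "[a]"] by simp
  show ?case
  proof (cases "fst a \<in> D \<and> (\<forall>b\<in>set p. (fst a, fst b) \<in> E)")
    case True
    then have "shuffle E (p @ [a]) (a # p)" using sym by (intro shuffle_move) (auto dest: symD)
    then have "shuffle E (w @ [a]) ((c @ [a]) @ p)"
      using shuffle_trans[OF 1 shuffle_append2] by simp
    moreover have "subseq (c @ [a]) (w @ [a])" using cp(2) by simp
    ultimately show ?thesis using cp True by (intro exI[of _ "c @ [a]"] exI[of _ p]) auto
  next
    case False
    have "\<not> initial E x (map fst (p @ [a]))" if "x \<in> D" for x
      using False cp(4)[OF that] that by (auto simp: initial_append)
    moreover have "subseq c (w @ [a])" using cp(2) by (meson list_emb_append2 subseq_order.order_trans subseq_rev_drop_many)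
    ultimately show ?thesis using cp(3) 1 by (intro exI[of _ c] exI[of _ "p @ [a]"]) auto
  qed
qed

section \<open>Graph products and their normal form\<close>

locale graph_of_groups =
  fixes V :: "'v set" and E :: "('v \<times> 'v) set" and G :: "'v \<Rightarrow> ('g, 'm) monoid_scheme"
  assumes simplicial: "simplicial_graph V E"
    and group_G: "\<And>v. v \<in> V \<Longrightarrow> group (G v)"
begin

abbreviation "P \<equiv> graph_product V E G"

abbreviation "prod_word \<equiv> word_prod V E G"

abbreviation "letters \<equiv> (SIGMA v:V. carrier (G v))"

lemma E_sub: "E \<subseteq> V \<times> V" and E_sym: "sym E" and E_irrefl: "irrefl E"
  using simplicial by (auto simp: simplicial_graph_def)

lemma E_in_V: "(v, w) \<in> E \<Longrightarrow> v \<in> V" "(v, w) \<in> E \<Longrightarrow> w \<in> V"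
  using E_sub by auto

lemma E_symD: "(v, w) \<in> E \<Longrightarrow> (w, v) \<in> E"
  using E_sym by (auto dest: symD)

lemma E_loop: "(v, v) \<notin> E"
  using E_irrefl by (auto simp: irrefl_def)

lemma group_P: "group P"
  by (rule group_graph_product[OF group_G E_sub])

lemma G_closed:
  assumes "v \<in> V"
  shows "\<one>\<^bsub>G v\<^esub> \<in> carrier (G v)"
    and "a \<in> carrier (G v) \<Longrightarrow> b \<in> carrier (G v) \<Longrightarrow> a \<otimes>\<^bsub>G v\<^esub> b \<in> carrier (G v)"
    and "a \<in> carrier (G v) \<Longrightarrow> inv\<^bsub>G v\<^esub> a \<in> carrier (G v)"
proof -
  interpret group "G v" by (rule group_G[OF assms])
  show "\<one>\<^bsub>G v\<^esub> \<in> carrier (G v)"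
    "a \<in> carrier (G v) \<Longrightarrow> b \<in> carrier (G v) \<Longrightarrow> a \<otimes>\<^bsub>G v\<^esub> b \<in> carrier (G v)"
    "a \<in> carrier (G v) \<Longrightarrow> inv\<^bsub>G v\<^esub> a \<in> carrier (G v)" by auto
qed

abbreviation "N \<equiv> normal_closure (free_product V G) (graph_commutators V E G)"

lemma N_normal: "N \<lhd> free_product V G"
  by (intro normal_normal_closure group_free_product graph_commutators_closed group_G E_sub)

lemma inj_closed:
  "v \<in> V \<Longrightarrow> a \<in> carrier (G v) \<Longrightarrow> free_inj V G v a \<in> carrier (free_product V G)"
  "v \<in> V \<Longrightarrow> a \<in> carrier (G v) \<Longrightarrow> graph_inj V E G v a \<in> carrier P"
  by (simp_all add: free_inj_closed graph_inj_closed)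

lemma inj_mult:
  assumes v: "v \<in> V" and a: "a \<in> carrier (G v)" "b \<in> carrier (G v)"
  shows "graph_inj V E G v a \<otimes>\<^bsub>P\<^esub> graph_inj V E G v b = graph_inj V E G v (a \<otimes>\<^bsub>G v\<^esub> b)"
proof -
  interpret N: normal N "free_product V G" by (rule N_normal)
  have w: "[(v, a)] \<in> free_words V G" "[(v, b)] \<in> free_words V G" "[] \<in> free_words V G"
    using v a by (auto simp: free_words_def)
  have "([(v, a), (v, b)], [(v, a \<otimes>\<^bsub>G v\<^esub> b)]) \<in> free_equiv V G"
    using free_equiv_step[OF free_step.mult[OF w(3) w(3) v a] group_G] by simp
  then have "free_inj V G v a \<otimes>\<^bsub>free_product V G\<^esub> free_inj V G v b = free_inj V G v (a \<otimes>\<^bsub>G v\<^esub> b)"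
    using free_class_mult[OF w(1,2)] by (simp add: free_inj_def free_class_eqI)
  then show ?thesis
    using N.rcos_sum[OF inj_closed(1)[OF v a(1)] inj_closed(1)[OF v a(2)]]
    by (simp add: graph_inj_def graph_product_def FactGroup_def)
qed

lemma inj_one:
  assumes v: "v \<in> V"
  shows "graph_inj V E G v \<one>\<^bsub>G v\<^esub> = \<one>\<^bsub>P\<^esub>"
proof -
  interpret P: group P by (rule group_P)
  let ?i = "graph_inj V E G v \<one>\<^bsub>G v\<^esub>"
  interpret Gv: group "G v" by (rule group_G[OF v])
  have "?i \<otimes>\<^bsub>P\<^esub> ?i = ?i" using inj_mult[OF v, of "\<one>\<^bsub>G v\<^esub>" "\<one>\<^bsub>G v\<^esub>"] by simp
  then show ?thesis using inj_closed(2)[OF v Gv.one_closed] by (metis P.r_cancel_one)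
qed

lemma inj_inv:
  assumes v: "v \<in> V" "a \<in> carrier (G v)"
  shows "graph_inj V E G v (inv\<^bsub>G v\<^esub> a) = inv\<^bsub>P\<^esub> (graph_inj V E G v a)"
proof -
  interpret P: group P by (rule group_P)
  interpret Gv: group "G v" by (rule group_G[OF v(1)])
  have "graph_inj V E G v (inv\<^bsub>G v\<^esub> a) \<otimes>\<^bsub>P\<^esub> graph_inj V E G v a = \<one>\<^bsub>P\<^esub>"
    using inj_mult[OF v(1), of "inv\<^bsub>G v\<^esub> a" a] inj_one[OF v(1)] v by simp
  then show ?thesis using v by (metis P.inv_equality inj_closed(2) Gv.inv_closed)
qed

lemma inj_commute:
  assumes e: "(v, w) \<in> E" and a: "a \<in> carrier (G v)" and b: "b \<in> carrier (G w)"
  shows "graph_inj V E G v a \<otimes>\<^bsub>P\<^esub> graph_inj V E G w b = graph_inj V E G w b \<otimes>\<^bsub>P\<^esub> graph_inj V E G v a"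
proof -
  let ?F = "free_product V G"
  interpret N: normal N ?F by (rule N_normal)
  let ?x = "free_inj V G v a" and ?y = "free_inj V G w b"
  have xy: "?x \<in> carrier ?F" "?y \<in> carrier ?F" using inj_closed(1) E_in_V[OF e] a b by simp_all
  let ?c = "?x \<otimes>\<^bsub>?F\<^esub> ?y \<otimes>\<^bsub>?F\<^esub> inv\<^bsub>?F\<^esub> ?x \<otimes>\<^bsub>?F\<^esub> inv\<^bsub>?F\<^esub> ?y"
  have "?c \<in> graph_commutators V E G" unfolding graph_commutators_def using e a b by blast
  then have c: "?c \<in> N" by (auto simp: normal_closure_def)
  have "?x \<otimes>\<^bsub>?F\<^esub> ?y = ?c \<otimes>\<^bsub>?F\<^esub> (?y \<otimes>\<^bsub>?F\<^esub> ?x)"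
    using xy by (simp add: N.m_assoc N.inv_solve_left)
      (simp flip: N.m_assoc)
  then have "N #>\<^bsub>?F\<^esub> (?x \<otimes>\<^bsub>?F\<^esub> ?y) = (N #>\<^bsub>?F\<^esub> ?c) #>\<^bsub>?F\<^esub> (?y \<otimes>\<^bsub>?F\<^esub> ?x)"
    using xy by (simp add: N.coset_mult_assoc N.subset)
  also have "N #>\<^bsub>?F\<^esub> ?c = N" using N.rcos_const[OF N.is_group c] .
  finally show ?thesis
    using N.rcos_sum[OF xy] N.rcos_sum[OF xy(2,1)]
    by (simp add: graph_inj_def graph_product_def FactGroup_def)
qed

lemma word_prod_Nil: "prod_word [] = \<one>\<^bsub>P\<^esub>"
  by (simp add: word_prod_def)

lemma word_prod_Cons: "prod_word ((v, g) # w) = graph_inj V E G v g \<otimes>\<^bsub>P\<^esub> prod_word w"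
  by (simp add: word_prod_def)

lemma word_prod_closed: "set w \<subseteq> letters \<Longrightarrow> prod_word w \<in> carrier P"
proof (induction w)
  interpret P: group P by (rule group_P)
  case Nil
  then show ?case by (simp add: word_prod_Nil)
next
  interpret P: group P by (rule group_P)
  case (Cons a w)
  then show ?case by (cases a) (auto simp: word_prod_Cons graph_inj_closed)
qed

lemma word_prod_append:
  "set u \<subseteq> letters \<Longrightarrow> set w \<subseteq> letters \<Longrightarrow> prod_word (u @ w) = prod_word u \<otimes>\<^bsub>P\<^esub> prod_word w"
proof (induction u)
  interpret P: group P by (rule group_P)
  case Nil
  then show ?case by (simp add: word_prod_Nil word_prod_closed)
next
  interpret P: group P by (rule group_P)
  case (Cons a w)
  then show ?case
    by (cases a) (auto simp: word_prod_Cons graph_inj_closed P.m_assoc word_prod_closed)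
qed

lemma ex_word:
  assumes "s \<in> carrier P"
  shows "\<exists>w. set w \<subseteq> letters \<and> prod_word w = s"
proof (rule graph_product_induct[where V = V and E = E and G = G and s = s
      and P = "\<lambda>s. \<exists>w. set w \<subseteq> letters \<and> prod_word w = s"])
  show "\<exists>w. set w \<subseteq> letters \<and> prod_word w = \<one>\<^bsub>P\<^esub>"
    by (rule exI[of _ "[]"]) (simp add: word_prod_Nil)
  fix v g t assume *: "v \<in> V" "g \<in> carrier (G v)" "\<exists>w. set w \<subseteq> letters \<and> prod_word w = t"
  then obtain w where "set w \<subseteq> letters" "prod_word w = t" by auto
  with * show "\<exists>w. set w \<subseteq> letters \<and> prod_word w = graph_inj V E G v g \<otimes>\<^bsub>P\<^esub> t"
    by (intro exI[of _ "(v, g) # w"]) (auto simp: word_prod_Cons)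
qed (fact group_G E_sub assms)+

definition inv_word :: "('v \<times> 'g) list \<Rightarrow> ('v \<times> 'g) list" where
  "inv_word w = rev (map (\<lambda>(v, g). (v, inv\<^bsub>G v\<^esub> g)) w)"

lemma inv_word_simps:
  "inv_word [] = []" "inv_word ((v, g) # w) = inv_word w @ [(v, inv\<^bsub>G v\<^esub> g)]"
  "inv_word (u @ w) = inv_word w @ inv_word u"
  by (simp_all add: inv_word_def)

lemma inv_word_letters: "set w \<subseteq> letters \<Longrightarrow> set (inv_word w) \<subseteq> letters"
  by (auto simp: inv_word_def G_closed)

lemma map_fst_inv_word: "map fst (inv_word w) = rev (map fst w)"
  by (simp add: inv_word_def rev_map[symmetric] case_prod_beta comp_def)

lemma word_prod_inv_word: "set w \<subseteq> letters \<Longrightarrow> prod_word (inv_word w) = inv\<^bsub>P\<^esub> (prod_word w)"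
proof (induction w)
  interpret P: group P by (rule group_P)
  case Nil
  then show ?case by (simp add: inv_word_simps word_prod_Nil)
next
  interpret P: group P by (rule group_P)
  case (Cons a w)
  obtain v g where a: "a = (v, g)" by force
  have v: "v \<in> V" "g \<in> carrier (G v)" "set w \<subseteq> letters" using Cons.prems by (auto simp: a)
  have c: "graph_inj V E G v g \<in> carrier P" "prod_word w \<in> carrier P"
    using v by (auto simp: graph_inj_closed word_prod_closed)
  have "prod_word (inv_word (a # w)) = prod_word (inv_word w) \<otimes>\<^bsub>P\<^esub> prod_word [(v, inv\<^bsub>G v\<^esub> g)]"
    using v by (simp add: a inv_word_simps word_prod_append inv_word_letters G_closed)
  also have "\<dots> = inv\<^bsub>P\<^esub> (prod_word w) \<otimes>\<^bsub>P\<^esub> inv\<^bsub>P\<^esub> (graph_inj V E G v g)"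
    using v c by (simp add: Cons.IH word_prod_Cons word_prod_Nil inj_inv)
  finally show ?case using c by (simp add: a word_prod_Cons P.inv_mult_group)
qed

lemma shuffle_word_prod: "shuffle E u w \<Longrightarrow> set u \<subseteq> letters \<Longrightarrow> prod_word u = prod_word w"
proof (induction rule: shuffle.induct)
  interpret P: group P by (rule group_P)
  case (shuffle_swap a b w)
  obtain v x g h where ab: "a = (v, g)" "b = (x, h)" by force
  have m: "graph_inj V E G v g \<in> carrier P" "graph_inj V E G x h \<in> carrier P" "prod_word w \<in> carrier P"
    using shuffle_swap by (auto simp: ab graph_inj_closed word_prod_closed)
  have "graph_inj V E G v g \<otimes>\<^bsub>P\<^esub> graph_inj V E G x h = graph_inj V E G x h \<otimes>\<^bsub>P\<^esub> graph_inj V E G v g"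
    using shuffle_swap by (intro inj_commute) (auto simp: ab)
  then show ?case using m by (simp add: ab word_prod_Cons flip: P.m_assoc)
next
  case (shuffle_Cons u w a)
  then show ?case by (cases a) (simp add: word_prod_Cons)
next
  case (shuffle_trans u w z)
  then show ?case using shuffle_set by metis
qed simp

definition reduced_words :: "('v \<times> 'g) list set" where
  "reduced_words = {w. set w \<subseteq> (SIGMA v:V. carrier (G v) - {\<one>\<^bsub>G v\<^esub>}) \<and> reduced_word E (map fst w)}"

lemma reduced_words_letters: "w \<in> reduced_words \<Longrightarrow> set w \<subseteq> letters"
  by (auto simp: reduced_words_def)

lemma Nil_reduced_words: "[] \<in> reduced_words"
  by (simp add: reduced_words_def reduced_word_Nil)

lemma Cons_reduced_words:
  "(v, g) # w \<in> reduced_words \<longleftrightarrow>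
    v \<in> V \<and> g \<in> carrier (G v) \<and> g \<noteq> \<one>\<^bsub>G v\<^esub> \<and> \<not> initial E v (map fst w) \<and> w \<in> reduced_words"
  by (auto simp: reduced_words_def reduced_word_Cons)

lemma shuffle_reduced_words: "shuffle E u w \<Longrightarrow> u \<in> reduced_words \<longleftrightarrow> w \<in> reduced_words"
  by (simp add: reduced_words_def shuffle_set[of E u w] shuffle_reduced_word[OF _ E_sym E_irrefl])

lemma inv_word_reduced_words:
  assumes "w \<in> reduced_words" shows "inv_word w \<in> reduced_words"
proof -
  have "inv\<^bsub>G v\<^esub> a \<noteq> \<one>\<^bsub>G v\<^esub>" if "v \<in> V" "a \<in> carrier (G v)" "a \<noteq> \<one>\<^bsub>G v\<^esub>" for v a
    using group.inv_eq_1_iff[OF group_G] that by auto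
  then show ?thesis
    using assms by (auto simp: reduced_words_def map_fst_inv_word reduced_word_rev inv_word_def G_closed)
      (use reduced_word_rev map_fst_inv_word inv_word_def in metis)
qed

text \<open>A reduced word is split as \<open>a z\<close>, where \<open>a\<close> is its initial letter over \<open>v\<close>, or \<open>\<one>\<close> if there is
  none: \<open>part\<close> returns \<open>a\<close> and \<open>rest\<close> returns \<open>z\<close>.\<close>

fun part :: "'v \<Rightarrow> ('v \<times> 'g) list \<Rightarrow> 'g" where
  "part v [] = \<one>\<^bsub>G v\<^esub>"
| "part v ((x, a) # w) = (if x = v then a else if (v, x) \<in> E then part v w else \<one>\<^bsub>G v\<^esub>)"

fun rest :: "'v \<Rightarrow> ('v \<times> 'g) list \<Rightarrow> ('v \<times> 'g) list" where
  "rest v [] = []"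
| "rest v ((x, a) # w) = (if x = v then w else if (v, x) \<in> E then (x, a) # rest v w else (x, a) # w)"

definition prepend :: "'v \<Rightarrow> 'g \<Rightarrow> ('v \<times> 'g) list \<Rightarrow> ('v \<times> 'g) list" where
  "prepend v g w = (if g = \<one>\<^bsub>G v\<^esub> then w else (v, g) # w)"

text \<open>Left multiplication by an element of \<open>G v\<close>, as an operation on reduced words.\<close>

definition lmul :: "'v \<Rightarrow> 'g \<Rightarrow> ('v \<times> 'g) list \<Rightarrow> ('v \<times> 'g) list" where
  "lmul v g w = prepend v (g \<otimes>\<^bsub>G v\<^esub> part v w) (rest v w)"

lemma part_closed: "v \<in> V \<Longrightarrow> set w \<subseteq> letters \<Longrightarrow> part v w \<in> carrier (G v)"
  by (induction v w rule: part.induct) (auto simp: G_closed)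

lemma subseq_rest: "subseq (rest v w) w"
  by (induction v w rule: rest.induct) auto

lemma initial_rest: "(v, x) \<in> E \<Longrightarrow> initial E x (map fst (rest v w)) = initial E x (map fst w)"
  by (induction v w rule: rest.induct) (auto dest: E_symD simp: E_loop)

lemma not_initial_rest: "w \<in> reduced_words \<Longrightarrow> \<not> initial E v (map fst (rest v w))"
  by (induction v w rule: rest.induct) (auto simp: Cons_reduced_words)

lemma rest_reduced_words: "w \<in> reduced_words \<Longrightarrow> rest v w \<in> reduced_words"
  by (induction v w rule: rest.induct) (auto simp: Cons_reduced_words initial_rest)

lemma not_initial_part_rest:
  "\<not> initial E v (map fst w) \<Longrightarrow> part v w = \<one>\<^bsub>G v\<^esub>"
  "\<not> initial E v (map fst w) \<Longrightarrow> rest v w = w"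
  by (induction v w rule: part.induct) auto

text \<open>Moving the initial letter over \<open>v\<close> to the front is a sequence of exchanges.\<close>

lemma prepend_part_rest:
  "w \<in> reduced_words \<Longrightarrow> shuffle E (prepend v (part v w) (rest v w)) w"
proof (induction v w rule: part.induct)
  case (1 v)
  show ?case by (simp add: prepend_def shuffle_refl)
next
  case (2 v x a w)
  have w: "w \<in> reduced_words" using 2 by (simp add: Cons_reduced_words)
  show ?case
  proof (cases "x \<noteq> v \<and> (v, x) \<in> E")
    case True
    have IH: "shuffle E ((x, a) # prepend v (part v w) (rest v w)) ((x, a) # w)"
      using 2 w True by (intro shuffle_Cons) auto
    have "shuffle E (prepend v (part v w) ((x, a) # rest v w)) ((x, a) # prepend v (part v w) (rest v w))"
      using True by (auto simp: prepend_def intro: shuffle_refl shuffle_swap)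
    from shuffle_trans[OF this IH] show ?thesis using True by simp
  qed (use 2 in \<open>auto simp: prepend_def Cons_reduced_words intro: shuffle_refl\<close>)
qed

lemma part_rest_prepend:
  assumes "\<not> initial E v (map fst w)"
  shows "part v (prepend v g w) = g" "rest v (prepend v g w) = w"
  using not_initial_part_rest[OF assms] by (auto simp: prepend_def)

lemma part_rest_prepend_adjacent:
  assumes "(v, x) \<in> E"
  shows "part v (prepend x k w) = part v w" "rest v (prepend x k w) = prepend x k (rest v w)"
  using assms by (auto simp: prepend_def E_loop)

lemma part_rest_adjacent: "(v, x) \<in> E \<Longrightarrow> part v (rest x w) = part v w"
  by (induction x w rule: rest.induct) (auto simp: E_loop dest: E_symD)

lemma rest_commute: "(v, x) \<in> E \<Longrightarrow> rest v (rest x w) = rest x (rest v w)"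
  by (induction x w rule: rest.induct) (auto simp: E_loop dest: E_symD)

lemma shuffle_part_rest:
  "shuffle E u w \<Longrightarrow> part v u = part v w \<and> shuffle E (rest v u) (rest v w)"
proof (induction rule: shuffle.induct)
  case (shuffle_swap a b w)
  obtain x g y h where ab: "a = (x, g)" "b = (y, h)" by force
  have "(x, y) \<in> E" "(y, x) \<in> E" "x \<noteq> y" using shuffle_swap E_symD E_loop by (auto simp: ab)
  then show ?case by (auto simp: ab intro: shuffle_refl shuffle.shuffle_swap)
next
  case (shuffle_Cons u w a)
  then show ?case by (cases a) (auto intro: shuffle.shuffle_Cons)
qed (auto intro: shuffle_refl shuffle_trans)

lemma shuffle_prepend: "shuffle E u w \<Longrightarrow> shuffle E (prepend v g u) (prepend v g w)"
  by (auto simp: prepend_def intro: shuffle_Cons)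

lemma shuffle_lmul: "shuffle E u w \<Longrightarrow> shuffle E (lmul v g u) (lmul v g w)"
  using shuffle_part_rest[of u w v] by (auto simp: lmul_def intro: shuffle_prepend)

lemma lmul_reduced_words:
  assumes "v \<in> V" "g \<in> carrier (G v)" "w \<in> reduced_words"
  shows "lmul v g w \<in> reduced_words"
  using assms part_closed[OF assms(1) reduced_words_letters[OF assms(3)]]
  by (auto simp: lmul_def prepend_def Cons_reduced_words not_initial_rest rest_reduced_words G_closed)

lemma lmul_lmul:
  assumes v: "v \<in> V" "g \<in> carrier (G v)" "h \<in> carrier (G v)" and w: "w \<in> reduced_words"
  shows "lmul v g (lmul v h w) = lmul v (g \<otimes>\<^bsub>G v\<^esub> h) w"
proof -
  interpret group "G v" by (rule group_G[OF v(1)])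
  show ?thesis
    using part_rest_prepend[OF not_initial_rest[OF w]] part_closed[OF v(1) reduced_words_letters[OF w]] v
    by (simp add: lmul_def m_assoc)
qed

lemma lmul_one:
  assumes v: "v \<in> V" and w: "w \<in> reduced_words"
  shows "shuffle E (lmul v \<one>\<^bsub>G v\<^esub> w) w"
proof -
  interpret group "G v" by (rule group_G[OF v(1)])
  show ?thesis
    using prepend_part_rest[OF w, of v] part_closed[OF v reduced_words_letters[OF w]]
    by (simp add: lmul_def)
qed

text \<open>For adjacent vertices the splittings with respect to \<open>v\<close> and \<open>x\<close> do not interfere, so both sides are the
  same word up to the order of the two letters in front.\<close>

lemma lmul_commute:
  assumes e: "(v, x) \<in> E"
  shows "shuffle E (lmul v g (lmul x h w)) (lmul x h (lmul v g w))"
proof -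
  have "x \<noteq> v" using e E_loop by auto
  then show ?thesis
    using e E_symD[OF e]
    by (simp add: lmul_def part_rest_prepend_adjacent part_rest_adjacent rest_commute[OF e])
      (auto simp: prepend_def intro: shuffle_refl shuffle_swap)
qed

lemma lmul_not_initial:
  assumes "\<not> initial E v (map fst w)" "v \<in> V" "g \<in> carrier (G v)" "g \<noteq> \<one>\<^bsub>G v\<^esub>"
  shows "lmul v g w = (v, g) # w"
proof -
  interpret group "G v" by (rule group_G[OF assms(2)])
  show ?thesis
    using assms by (simp add: lmul_def not_initial_part_rest prepend_def)
qed

text \<open>The laws of an action hold for \<open>lmul\<close> only up to exchanges, so the group has to act on
  classes.\<close>

definition shuffle_class :: "('v \<times> 'g) list \<Rightarrow> ('v \<times> 'g) list set" where
  "shuffle_class w = {z \<in> reduced_words. shuffle E w z}"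

lemma shuffle_class_eq_iff:
  assumes "w \<in> reduced_words" "z \<in> reduced_words"
  shows "shuffle_class w = shuffle_class z \<longleftrightarrow> shuffle E w z"
proof
  assume "shuffle_class w = shuffle_class z"
  moreover have "z \<in> shuffle_class z" using assms by (simp add: shuffle_class_def shuffle_refl)
  ultimately show "shuffle E w z" by (auto simp: shuffle_class_def)
next
  assume "shuffle E w z"
  then show "shuffle_class w = shuffle_class z"
    using shuffle_sym[OF _ E_sym] by (auto simp: shuffle_class_def intro: shuffle_trans)
qed

definition class_act :: "'v \<Rightarrow> 'g \<Rightarrow> ('v \<times> 'g) list set \<Rightarrow> ('v \<times> 'g) list set" where
  "class_act v g = restrict (\<lambda>C. shuffle_class (lmul v g (SOME w. w \<in> C))) (shuffle_class ` reduced_words)"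

lemma class_act:
  assumes "v \<in> V" "g \<in> carrier (G v)" "w \<in> reduced_words"
  shows "class_act v g (shuffle_class w) = shuffle_class (lmul v g w)"
proof -
  define z where "z = (SOME z. z \<in> shuffle_class w)"
  have "w \<in> shuffle_class w" using assms by (simp add: shuffle_class_def shuffle_refl)
  then have "z \<in> shuffle_class w" unfolding z_def by (rule someI)
  then have z: "z \<in> reduced_words" "shuffle E w z" by (auto simp: shuffle_class_def)
  have "shuffle_class (lmul v g z) = shuffle_class (lmul v g w)"
    using assms z by (subst shuffle_class_eq_iff)
      (auto simp: lmul_reduced_words intro: shuffle_lmul shuffle_sym[OF _ E_sym])
  then show ?thesis using assms by (simp add: class_act_def z_def)
qed

lemma class_act_closed:
  assumes "v \<in> V" "g \<in> carrier (G v)" "C \<in> shuffle_class ` reduced_words"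
  shows "class_act v g C \<in> shuffle_class ` reduced_words"
  using assms by (auto simp: class_act lmul_reduced_words)

lemma class_act_mult:
  assumes v: "v \<in> V" "g \<in> carrier (G v)" "h \<in> carrier (G v)" and C: "C \<in> shuffle_class ` reduced_words"
  shows "class_act v g (class_act v h C) = class_act v (g \<otimes>\<^bsub>G v\<^esub> h) C"
  using assms by (auto simp: class_act lmul_reduced_words lmul_lmul G_closed)

lemma class_act_one:
  assumes v: "v \<in> V" and C: "C \<in> shuffle_class ` reduced_words"
  shows "class_act v \<one>\<^bsub>G v\<^esub> C = C"
proof -
  obtain w where w: "w \<in> reduced_words" "C = shuffle_class w" using C by auto
  have "shuffle_class (lmul v \<one>\<^bsub>G v\<^esub> w) = shuffle_class w"
    using shuffle_class_eq_iff lmul_reduced_words lmul_one v w G_closed by simp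
  then show ?thesis using v w by (simp add: class_act G_closed)
qed

lemma class_act_Bij:
  assumes v: "v \<in> V" "g \<in> carrier (G v)"
  shows "class_act v g \<in> Bij (shuffle_class ` reduced_words)"
proof -
  interpret group "G v" by (rule group_G[OF v(1)])
  have "bij_betw (class_act v g) (shuffle_class ` reduced_words) (shuffle_class ` reduced_words)"
    by (rule bij_betw_byWitness[where f' = "class_act v (inv\<^bsub>G v\<^esub> g)"])
      (use v in \<open>auto simp: class_act_mult class_act_one class_act_closed\<close>)
  then show ?thesis by (simp add: Bij_def class_act_def)
qed

text \<open>The actions of the vertex groups on the classes of reduced words extend to the graph product by its
  universal property. Reading a reduced word from the right, each letter acts on the class of the empty word by
  being put in front, because reducedness excludes that it merges with an earlier letter. So the class of
  the word can be recovered from the group element.\<close>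

theorem normal_form:
  assumes w: "w \<in> reduced_words" and z: "z \<in> reduced_words" and eq: "prod_word w = prod_word z"
  shows "shuffle E w z"
proof -
  let ?S = "shuffle_class ` reduced_words"
  let ?B = "BijGroup ?S"
  have "\<exists>F \<in> hom P ?B. \<forall>v\<in>V. \<forall>g\<in>carrier (G v). F (graph_inj V E G v g) = class_act v g"
  proof (rule graph_product_universal[OF group_G E_sub group_BijGroup])
    fix v assume v: "v \<in> V"
    show "class_act v \<in> hom (G v) ?B"
    proof (rule homI)
      fix g h assume gh: "g \<in> carrier (G v)" "h \<in> carrier (G v)"
      show "class_act v g \<in> carrier ?B" using class_act_Bij[OF v gh(1)] by (simp add: BijGroup_def)
      have "class_act v (g \<otimes>\<^bsub>G v\<^esub> h) = compose ?S (class_act v g) (class_act v h)"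
        using v gh by (auto simp: compose_def fun_eq_iff class_act_mult class_act_def[of v "g \<otimes>\<^bsub>G v\<^esub> h"])
      then show "class_act v (g \<otimes>\<^bsub>G v\<^esub> h) = class_act v g \<otimes>\<^bsub>?B\<^esub> class_act v h"
        using class_act_Bij v gh by (simp add: BijGroup_def)
    qed
  next
    fix v x g h assume e: "(v, x) \<in> E" and g: "g \<in> carrier (G v)" and h: "h \<in> carrier (G x)"
    have vx: "v \<in> V" "x \<in> V" using E_in_V e by auto
    have "class_act v g (class_act x h C) = class_act x h (class_act v g C)" if C: "C \<in> ?S" for C
    proof -
      obtain w where w: "w \<in> reduced_words" "C = shuffle_class w" using C by auto
      have "shuffle_class (lmul v g (lmul x h w)) = shuffle_class (lmul x h (lmul v g w))"
        using shuffle_class_eq_iff lmul_reduced_words lmul_commute[OF e] vx g h w by simp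
      then show ?thesis using vx g h w by (simp add: class_act lmul_reduced_words)
    qed
    then have "compose ?S (class_act v g) (class_act x h) = compose ?S (class_act x h) (class_act v g)"
      by (auto simp: compose_def fun_eq_iff)
    then show "class_act v g \<otimes>\<^bsub>?B\<^esub> class_act x h = class_act x h \<otimes>\<^bsub>?B\<^esub> class_act v g"
      using class_act_Bij vx g h by (simp add: BijGroup_def)
  qed
  then obtain F where F: "F \<in> hom P ?B"
    "\<And>v g. v \<in> V \<Longrightarrow> g \<in> carrier (G v) \<Longrightarrow> F (graph_inj V E G v g) = class_act v g" by auto
  interpret F: group_hom P ?B F
    by (intro group_hom.intro group_hom_axioms.intro F group_P group_BijGroup)
  have Nil: "shuffle_class [] \<in> ?S" using Nil_reduced_words by simp
  have F_word: "F (prod_word w) (shuffle_class []) = shuffle_class w" if "w \<in> reduced_words" for w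
    using that
  proof (induction w)
    case Nil
    have "F (prod_word []) = \<one>\<^bsub>?B\<^esub>" by (simp only: word_prod_Nil F.hom_one)
    then show ?case using Nil_reduced_words by (simp add: BijGroup_def)
  next
    case (Cons a w)
    obtain v g where a: "a = (v, g)" by force
    have v: "v \<in> V" "g \<in> carrier (G v)" "g \<noteq> \<one>\<^bsub>G v\<^esub>" "\<not> initial E v (map fst w)"
      and w: "w \<in> reduced_words"
      using Cons.prems by (auto simp: a Cons_reduced_words)
    have c: "prod_word w \<in> carrier P" by (rule word_prod_closed[OF reduced_words_letters[OF w]])
    have "F (prod_word (a # w)) = class_act v g \<otimes>\<^bsub>?B\<^esub> F (prod_word w)"
      using v c by (simp add: a word_prod_Cons inj_closed F(2))
    also have "\<dots> = compose ?S (class_act v g) (F (prod_word w))"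
      using class_act_Bij[OF v(1,2)] F.hom_closed[OF c] by (simp add: BijGroup_def)
    finally have "F (prod_word (a # w)) (shuffle_class []) = class_act v g (shuffle_class w)"
      using Nil Cons.IH[OF w] by (simp add: compose_def)
    then show ?case using v w by (simp add: a class_act lmul_not_initial)
  qed
  have "shuffle_class w = shuffle_class z" using F_word[OF w] F_word[OF z] eq by simp
  then show ?thesis by (simp add: shuffle_class_eq_iff w z)
qed

lemma word_prod_part_rest:
  assumes v: "v \<in> V" and w: "w \<in> reduced_words"
  shows "prod_word w = graph_inj V E G v (part v w) \<otimes>\<^bsub>P\<^esub> prod_word (rest v w)"
proof -
  interpret P: group P by (rule group_P)
  have "prod_word (rest v w) \<in> carrier P"
    by (rule word_prod_closed[OF reduced_words_letters[OF rest_reduced_words[OF w]]])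
  moreover have "prod_word w = prod_word (prepend v (part v w) (rest v w))"
    by (rule shuffle_word_prod[OF shuffle_sym[OF prepend_part_rest[OF w] E_sym] reduced_words_letters[OF w]])
  ultimately show ?thesis using inj_one[OF v] by (auto simp: prepend_def word_prod_Cons)
qed

lemma word_prod_lmul:
  assumes v: "v \<in> V" "g \<in> carrier (G v)" and w: "w \<in> reduced_words"
  shows "prod_word (lmul v g w) = graph_inj V E G v g \<otimes>\<^bsub>P\<^esub> prod_word w"
proof -
  interpret P: group P by (rule group_P)
  have c: "prod_word (rest v w) \<in> carrier P"
    by (rule word_prod_closed[OF reduced_words_letters[OF rest_reduced_words[OF w]]])
  have "prod_word (lmul v g w) = graph_inj V E G v (g \<otimes>\<^bsub>G v\<^esub> part v w) \<otimes>\<^bsub>P\<^esub> prod_word (rest v w)"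
    using inj_one[OF v(1)] c by (auto simp: lmul_def prepend_def word_prod_Cons)
  then show ?thesis
    using v c part_closed[OF v(1) reduced_words_letters[OF w]]
    by (simp add: word_prod_part_rest[OF v(1) w] inj_closed inj_mult[symmetric] P.m_assoc)
qed

lemma ex_reduced_word:
  "set w \<subseteq> letters \<Longrightarrow> \<exists>z \<in> reduced_words. prod_word z = prod_word w \<and> subseq (map fst z) (map fst w)"
proof (induction w)
  case Nil
  then show ?case using Nil_reduced_words by auto
next
  case (Cons a w)
  obtain v g where a: "a = (v, g)" by force
  have v: "v \<in> V" "g \<in> carrier (G v)" using Cons.prems by (auto simp: a)
  obtain z where z: "z \<in> reduced_words" "prod_word z = prod_word w" "subseq (map fst z) (map fst w)"
    using Cons by auto
  have "subseq (map fst (lmul v g z)) (v # map fst z)"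
    using subseq_map[OF subseq_rest, of fst v z] by (auto simp: lmul_def prepend_def)
  also have "subseq (v # map fst z) (v # map fst w)" using z by simp
  finally have "subseq (map fst (lmul v g z)) (map fst (a # w))" by (simp add: a)
  then show ?case
    using v z by (intro bexI[of _ "lmul v g z"]) (auto simp: a word_prod_lmul word_prod_Cons lmul_reduced_words)
qed

section \<open>Splitting off a vertex\<close>

text \<open>These words represent the elements of \<open>G v\<^sub>1 \<cdots> G v\<^sub>n\<close> for \<open>vs = [v\<^sub>1, \<dots>, v\<^sub>n]\<close>. Subsequences, in place
  of words with neutral letters, let reduced words belong to this set.\<close>

definition words_below :: "'v list \<Rightarrow> ('v \<times> 'g) list set" where
  "words_below vs = {w. set w \<subseteq> letters \<and> subseq (map fst w) vs}"

definition star :: "'v \<Rightarrow> 'v set" where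
  "star v = {x. x = v \<or> (v, x) \<in> E}"

text \<open>No letter over \<open>v\<close> or over a neighbour of \<open>v\<close> can be moved to the front of \<open>p\<close>.\<close>

definition star_free :: "'v \<Rightarrow> ('v \<times> 'g) list \<Rightarrow> bool" where
  "star_free v p \<longleftrightarrow> (\<forall>x\<in>star v. \<not> initial E x (map fst p))"

lemma reduced_words_appendD:
  "x @ y \<in> reduced_words \<Longrightarrow> x \<in> reduced_words \<and> y \<in> reduced_words"
  by (induction x) (auto simp: Cons_reduced_words initial_append Nil_reduced_words)

text \<open>After a possible first letter over \<open>v\<close>, the word is reduced without leaving \<open>words_below vs\<close>; then the
  initial letter over \<open>v\<close> is extracted, and finally the initial letters over neighbours of \<open>v\<close> are collected
  in \<open>c\<close>. The word \<open>c @ p\<close> itself need not have a vertex sequence below \<open>vs\<close>, since letters were exchanged;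
  \<open>r\<close> is a word for the same element that has.\<close>

lemma amalgam_decomposition:
  assumes w: "w \<in> words_below (v # vs)" and v: "v \<in> V"
  shows "\<exists>g c p r. g \<in> carrier (G v) \<and> prod_word w = prod_word ((v, g) # c @ p)
    \<and> c \<in> reduced_words \<and> fst ` set c \<subseteq> {x. (v, x) \<in> E} \<and> p \<in> reduced_words \<and> star_free v p
    \<and> c \<in> words_below vs \<and> r \<in> words_below vs \<and> prod_word r = prod_word (c @ p)"
proof -
  interpret P: group P by (rule group_P)
  interpret Gv: group "G v" by (rule group_G[OF v])
  have "\<exists>g0 w0. g0 \<in> carrier (G v) \<and> w0 \<in> words_below vs \<and> prod_word w = graph_inj V E G v g0 \<otimes>\<^bsub>P\<^esub> prod_word w0"
  proof (cases "subseq (map fst w) vs")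
    case True
    then show ?thesis using w v
      by (intro exI[of _ "\<one>\<^bsub>G v\<^esub>"] exI[of _ w]) (auto simp: words_below_def inj_one word_prod_closed)
  next
    case False
    then obtain g0 w0 where "w = (v, g0) # w0" "subseq (map fst w0) vs"
      using w by (cases w) (auto simp: words_below_def split: if_splits)
    then show ?thesis using w by (auto simp: words_below_def word_prod_Cons)
  qed
  then obtain g0 w0 where g0: "g0 \<in> carrier (G v)" and w0: "w0 \<in> words_below vs"
    and w_eq: "prod_word w = graph_inj V E G v g0 \<otimes>\<^bsub>P\<^esub> prod_word w0" by blast
  obtain z where z: "z \<in> reduced_words" "prod_word z = prod_word w0" "subseq (map fst z) (map fst w0)"
    using ex_reduced_word[of w0] w0 by (auto simp: words_below_def)
  define a r where "a = part v z" and "r = rest v z"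
  have a: "a \<in> carrier (G v)" using part_closed[OF v reduced_words_letters[OF z(1)]] by (simp add: a_def)
  have r: "r \<in> reduced_words" using rest_reduced_words[OF z(1)] by (simp add: r_def)
  have "subseq (map fst r) (map fst z)" unfolding r_def by (intro subseq_map subseq_rest)
  then have rvs: "subseq (map fst r) vs"
    using z(3) w0 by (auto simp: words_below_def intro: subseq_order.order_trans)
  have rT: "r \<in> words_below vs" using reduced_words_letters[OF r] rvs by (simp add: words_below_def)
  have rc: "prod_word r \<in> carrier P" by (rule word_prod_closed[OF reduced_words_letters[OF r]])
  have z_eq: "prod_word z = graph_inj V E G v a \<otimes>\<^bsub>P\<^esub> prod_word r"
    unfolding a_def r_def by (rule word_prod_part_rest[OF v z(1)])
  obtain c p where cp: "shuffle E r (c @ p)" "subseq c r" "fst ` set c \<subseteq> {x. (v, x) \<in> E}"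
    "\<And>x. (v, x) \<in> E \<Longrightarrow> \<not> initial E x (map fst p)"
    using ex_split_commuting_prefix[OF E_sym, of "{x. (v, x) \<in> E}" r] E_loop by auto
  have cp_red: "c @ p \<in> reduced_words" using shuffle_reduced_words[OF cp(1)] r by simp
  have "\<not> initial E v (map fst (c @ p))"
    using not_initial_rest[OF z(1), of v] shuffle_initial[OF cp(1) E_sym, of v] by (simp add: r_def)
  then have "\<not> initial E v (map fst p)"
    using cp(3) by (auto simp: initial_append)
  then have "star_free v p" using cp(4) by (auto simp: star_free_def star_def)
  moreover have "prod_word r = prod_word (c @ p)" by (rule shuffle_word_prod[OF cp(1) reduced_words_letters[OF r]])
  moreover have "prod_word w = prod_word ((v, g0 \<otimes>\<^bsub>G v\<^esub> a) # c @ p)"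
    using w_eq z(2)[symmetric] z_eq rc a g0 v
    by (simp add: word_prod_Cons inj_mult[symmetric] P.m_assoc inj_closed calculation(2)[symmetric])
  moreover have "c \<in> words_below vs"
    using reduced_words_appendD[OF cp_red] reduced_words_letters subseq_map[OF cp(2), of fst] rvs
    by (auto simp: words_below_def intro: subseq_order.order_trans)
  ultimately show ?thesis
    using reduced_words_appendD[OF cp_red] cp(3) rT a g0
    by (intro exI[of _ "g0 \<otimes>\<^bsub>G v\<^esub> a"] exI[of _ c] exI[of _ p] exI[of _ r]) auto
qed

lemma reduced_words_append:
  assumes "u \<in> reduced_words" "w \<in> reduced_words"
    "\<And>x. initial E x (rev (map fst u)) \<Longrightarrow> \<not> initial E x (map fst w)"
  shows "u @ w \<in> reduced_words"
  using assms by (auto simp: reduced_words_def intro: reduced_word_append)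

lemma reduced_commuting_append:
  assumes c: "c \<in> reduced_words" "fst ` set c \<subseteq> {x. (v, x) \<in> E}"
    and p: "p \<in> reduced_words" "star_free v p"
  shows "c @ p \<in> reduced_words"
proof (rule reduced_words_append[OF c(1) p(1)])
  fix x assume "initial E x (rev (map fst c))"
  then have "(v, x) \<in> E" using initial_in_set[of E x "rev (map fst c)"] c(2) by auto
  then show "\<not> initial E x (map fst p)" using p(2) by (auto simp: star_free_def star_def)
qed

text \<open>A cancellation would pair two letters of different blocks over the same vertex. Letters of \<open>c\<close> and \<open>b\<close> lie
  over the star of \<open>v\<close>, where \<open>p\<close> and \<open>q\<close> have no initial letters. A letter of \<open>p\<close> that could meet one of
  \<open>q\<close> lies outside the star, so it does not commute with \<open>b\<close> between them.\<close>

lemma reduced_sandwich: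
  assumes c: "c \<in> reduced_words" "fst ` set c \<subseteq> {x. (v, x) \<in> E}"
    and p: "p \<in> reduced_words" "star_free v p" and q: "q \<in> reduced_words" "star_free v q"
    and v: "v \<in> V" and b: "b \<in> carrier (G v)" "b \<noteq> \<one>\<^bsub>G v\<^esub>"
  shows "inv_word p @ c @ (v, b) # q \<in> reduced_words"
proof -
  have star: "\<not> initial E x (map fst q)" "\<not> initial E x (map fst p)" if "x = v \<or> (v, x) \<in> E" for x
    using that p(2) q(2) by (auto simp: star_free_def star_def)
  have cx: "(v, x) \<in> E" if "initial E x (map fst c) \<or> initial E x (rev (map fst c))" for x
    using that initial_in_set[of E x "map fst c"] initial_in_set[of E x "rev (map fst c)"] c(2) by auto
  have 1: "(v, b) # q \<in> reduced_words" using star v b q by (simp add: Cons_reduced_words)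
  have 2: "c @ (v, b) # q \<in> reduced_words"
    by (rule reduced_words_append[OF c(1) 1]) (use star cx E_loop in auto)
  show ?thesis
  proof (rule reduced_words_append[OF inv_word_reduced_words[OF p(1)] 2])
    fix x assume "initial E x (rev (map fst (inv_word p)))"
    then have x: "initial E x (map fst p)" by (simp add: map_fst_inv_word)
    then have "x \<noteq> v" "(v, x) \<notin> E" using star(2)[of x] by auto
    then show "\<not> initial E x (map fst (c @ (v, b) # q))"
      using cx[of x] E_symD[of x v] by (auto simp: initial_append)
  qed
qed

end

section \<open>Values along words\<close>

locale graph_of_pd_functions = graph_of_groups V E G
  for V :: "'v set" and E and G :: "'v \<Rightarrow> ('g, 'm) monoid_scheme" +
  fixes X :: "'x topology" and \<alpha> :: "'v \<Rightarrow> 'g \<Rightarrow> 'x \<Rightarrow> 'x" and ht :: "'v \<Rightarrow> 'g \<times> 'x \<Rightarrow> complex"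
  assumes action: "\<And>v. v \<in> V \<Longrightarrow> homeo_action (G v) X (\<alpha> v)"
    and pd: "\<And>v. v \<in> V \<Longrightarrow> tg_positive_definite (G v) X (\<alpha> v) (ht v)"
    and unital: "\<And>v. v \<in> V \<Longrightarrow> tg_unital (G v) X (ht v)"
    and actions_comm: "actions_commute E G X \<alpha>"
    and multipliers_comm: "multipliers_commute E G X \<alpha> (\<lambda>v. curry (ht v))"
begin

abbreviation "S \<equiv> topspace X"

lemma \<alpha>_closed: "v \<in> V \<Longrightarrow> g \<in> carrier (G v) \<Longrightarrow> x \<in> S \<Longrightarrow> \<alpha> v g x \<in> S"
  using action group_action.element_image by (fastforce simp: homeo_action_def)

lemma \<alpha>_mult:
  assumes "v \<in> V" "g \<in> carrier (G v)" "k \<in> carrier (G v)" "x \<in> S"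
  shows "\<alpha> v g (\<alpha> v k x) = \<alpha> v (g \<otimes>\<^bsub>G v\<^esub> k) x"
proof -
  interpret group_action "G v" S "\<alpha> v" using action[OF assms(1)] by (simp add: homeo_action_def)
  show ?thesis using composition_rule[OF assms(4,2,3)] by simp
qed

lemma \<alpha>_one:
  assumes "v \<in> V" "x \<in> S"
  shows "\<alpha> v \<one>\<^bsub>G v\<^esub> x = x"
proof -
  interpret group_action "G v" S "\<alpha> v" using action[OF assms(1)] by (simp add: homeo_action_def)
  show ?thesis using id_eq_one assms(2) by (metis restrict_apply')
qed

lemma \<alpha>_commute:
  assumes "(v, w) \<in> E" "g \<in> carrier (G v)" "k \<in> carrier (G w)" "x \<in> S"
  shows "\<alpha> v g (\<alpha> w k x) = \<alpha> w k (\<alpha> v g x)"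
  using actions_comm assms unfolding actions_commute_def by fastforce

text \<open>The commutation of the multipliers, with the inverse in the induced action removed.\<close>

lemma ht_invariant:
  assumes e: "(v, w) \<in> E" and g: "g \<in> carrier (G v)" and k: "k \<in> carrier (G w)" and x: "x \<in> S"
  shows "ht v (g, \<alpha> w k x) = ht v (g, x)"
proof -
  interpret group "G w" by (rule group_G[OF E_in_V(2)[OF e]])
  have "induced_action (G w) (\<alpha> w) (inv\<^bsub>G w\<^esub> k) (curry (ht v) g) x = curry (ht v) g x"
    using multipliers_comm e g x inv_closed[OF k] unfolding multipliers_commute_def by fast
  then show ?thesis using k by (simp add: induced_action_def)
qed

lemma ht_one: "v \<in> V \<Longrightarrow> x \<in> S \<Longrightarrow> ht v (\<one>\<^bsub>G v\<^esub>, x) = 1"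
  using unital by (simp add: tg_unital_def)

lemma vertex_kernel:
  assumes v: "v \<in> V" and x: "x \<in> S"
  shows "pos_kernel (carrier (G v)) (\<lambda>g k. ht v (inv\<^bsub>G v\<^esub> g \<otimes>\<^bsub>G v\<^esub> k, \<alpha> v (inv\<^bsub>G v\<^esub> k) x))"
proof (rule pos_kernelI_psd_matrix)
  interpret group "G v" by (rule group_G[OF v])
  fix n and f :: "nat \<Rightarrow> 'g"
  assume f: "\<And>i. i < n \<Longrightarrow> f i \<in> carrier (G v)"
  define \<eta> where "\<eta> i = (f i, \<alpha> v (inv\<^bsub>G v\<^esub> f i) x)" for i
  have "\<eta> i \<in> tg_arrows (G v) X \<and> tg_range (\<alpha> v) (\<eta> i) = x" if "i < n" for i
    using f[OF that] v x by (simp add: \<eta>_def tg_arrows_def tg_range_def \<alpha>_closed \<alpha>_mult \<alpha>_one)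
  then have "psd_matrix n (\<lambda>i j. ht v (tg_mult (G v) (tg_inv (G v) (\<alpha> v) (\<eta> i)) (\<eta> j)))"
    using pd[OF v] x unfolding tg_positive_definite_def by blast
  then show "psd_matrix n (\<lambda>i j. ht v (inv\<^bsub>G v\<^esub> f i \<otimes>\<^bsub>G v\<^esub> f j, \<alpha> v (inv\<^bsub>G v\<^esub> f j) x))"
    by (simp add: tg_mult_def tg_inv_def \<eta>_def)
qed

lemma ht_inv:
  assumes v: "v \<in> V" and g: "g \<in> carrier (G v)" and x: "x \<in> S"
  shows "ht v (inv\<^bsub>G v\<^esub> g, \<alpha> v g x) = cnj (ht v (g, x))"
proof -
  interpret group "G v" by (rule group_G[OF v])
  show ?thesis
    using pos_kernel_hermitian[OF vertex_kernel[OF v \<alpha>_closed[OF v g x]] one_closed g] v g x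
    by (simp add: \<alpha>_mult \<alpha>_one \<alpha>_closed)
qed

definition "\<beta> = graph_action V E G X \<alpha>"

lemma \<beta>_homeo_action: "homeo_action P X \<beta>"
  and \<beta>_inj: "v \<in> V \<Longrightarrow> g \<in> carrier (G v) \<Longrightarrow> \<beta> (graph_inj V E G v g) = \<alpha> v g"
  using theI'[OF graph_action_ex1[OF group_G E_sub action actions_comm]]
  by (auto simp: \<beta>_def graph_action_def)

interpretation \<beta>: group_action P S \<beta>
  using \<beta>_homeo_action by (simp add: homeo_action_def)

interpretation P: group P by (rule group_P)

definition move :: "('v \<times> 'g) list \<Rightarrow> 'x \<Rightarrow> 'x" where
  "move w = \<beta> (prod_word w)"

lemma move_closed: "set w \<subseteq> letters \<Longrightarrow> x \<in> S \<Longrightarrow> move w x \<in> S"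
  unfolding move_def by (rule \<beta>.element_image[OF word_prod_closed _ refl])

lemma move_Nil: "x \<in> S \<Longrightarrow> move [] x = x"
  unfolding move_def word_prod_Nil using \<beta>.id_eq_one by (metis restrict_apply')

lemma move_append:
  "set u \<subseteq> letters \<Longrightarrow> set w \<subseteq> letters \<Longrightarrow> x \<in> S \<Longrightarrow> move (u @ w) x = move u (move w x)"
  by (simp add: move_def word_prod_append \<beta>.composition_rule word_prod_closed)

lemma move_Cons:
  "v \<in> V \<Longrightarrow> g \<in> carrier (G v) \<Longrightarrow> set w \<subseteq> letters \<Longrightarrow> x \<in> S \<Longrightarrow> move ((v, g) # w) x = \<alpha> v g (move w x)"
  by (simp add: move_def word_prod_Cons \<beta>.composition_rule word_prod_closed inj_closed \<beta>_inj)

lemma move_inv_move: "set w \<subseteq> letters \<Longrightarrow> x \<in> S \<Longrightarrow> move (inv_word w) (move w x) = x"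
  by (simp add: move_def word_prod_inv_word \<beta>.orbit_sym_aux word_prod_closed)

lemma move_move_inv: "set w \<subseteq> letters \<Longrightarrow> x \<in> S \<Longrightarrow> move w (move (inv_word w) x) = x"
  using \<beta>.orbit_sym_aux[of "inv\<^bsub>P\<^esub> (prod_word w)" x] by (simp add: move_def word_prod_inv_word word_prod_closed)

lemma move_cong: "prod_word u = prod_word w \<Longrightarrow> move u = move w"
  by (simp add: move_def)

text \<open>The value of the multiplier along a word, computed letter by letter: each letter is evaluated at the
  point to which the letters on its right have moved \<open>x\<close>.\<close>

fun wmult :: "('v \<times> 'g) list \<Rightarrow> 'x \<Rightarrow> complex" where
  "wmult [] x = 1"
| "wmult ((v, g) # w) x = ht v (g, move w x) * wmult w x"

lemma word_multiplier_eq_wmult: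
  "set w \<subseteq> letters \<Longrightarrow> x \<in> S \<Longrightarrow> word_multiplier V E G X \<alpha> (\<lambda>v. curry (ht v)) w x = wmult w x"
proof (induction w)
  case (Cons a w)
  obtain v g where a: "a = (v, g)" by force
  have "inv\<^bsub>P\<^esub> (inv\<^bsub>P\<^esub> (prod_word w)) = prod_word w" using Cons.prems by (simp add: word_prod_closed)
  then show ?case
    using Cons by (simp add: word_multiplier_def prod.lessThan_Suc_shift a induced_action_def move_def \<beta>_def del: prod.lessThan_Suc)
qed (simp add: word_multiplier_def)

lemma wmult_append:
  "set u \<subseteq> letters \<Longrightarrow> set w \<subseteq> letters \<Longrightarrow> x \<in> S \<Longrightarrow> wmult (u @ w) x = wmult u (move w x) * wmult w x"
  by (induction u) (auto simp: move_append)

text \<open>Going back along a word visits the same points, and the vertex functions take conjugate values at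
  inverse arrows.\<close>

lemma wmult_inv_word:
  "set w \<subseteq> letters \<Longrightarrow> x \<in> S \<Longrightarrow> wmult (inv_word w) (move w x) = cnj (wmult w x)"
proof (induction w)
  case (Cons a w)
  obtain v g where a: "a = (v, g)" by force
  have v: "v \<in> V" "g \<in> carrier (G v)" "set w \<subseteq> letters" using Cons.prems by (auto simp: a)
  interpret Gv: group "G v" by (rule group_G[OF v(1)])
  define y where "y = move w x"
  have y: "y \<in> S" using v Cons.prems by (simp add: y_def move_closed)
  have 1: "move [(v, inv\<^bsub>G v\<^esub> g)] (\<alpha> v g y) = y"
    using v y by (simp add: move_Cons move_Nil \<alpha>_closed \<alpha>_mult \<alpha>_one)
  have "wmult (inv_word (a # w)) (move (a # w) x) = wmult (inv_word w) y * ht v (inv\<^bsub>G v\<^esub> g, \<alpha> v g y)"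
    using v y Cons.prems
    by (simp add: a inv_word_simps move_Cons wmult_append inv_word_letters \<alpha>_closed 1 move_Nil flip: y_def)
  then show ?case using Cons v y by (simp add: a y_def ht_inv)
qed (simp add: inv_word_simps)

lemma shuffle_wmult: "shuffle E u w \<Longrightarrow> set u \<subseteq> letters \<Longrightarrow> x \<in> S \<Longrightarrow> wmult u x = wmult w x"
proof (induction rule: shuffle.induct)
  case (shuffle_swap a b w)
  obtain v g y k where ab: "a = (v, g)" "b = (y, k)" by force
  have e: "(v, y) \<in> E" "(y, v) \<in> E" using shuffle_swap E_symD by (auto simp: ab)
  show ?case using shuffle_swap by (simp add: ab move_Cons move_closed ht_invariant[OF e(1)] ht_invariant[OF e(2)])
next
  case (shuffle_Cons u w a)
  obtain v g where a: "a = (v, g)" by force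
  have "move u = move w" using shuffle_word_prod[OF shuffle_Cons.hyps] shuffle_Cons.prems by (intro move_cong) simp
  then show ?case using shuffle_Cons by (simp add: a)
next
  case (shuffle_trans u w z)
  then show ?case using shuffle_set by metis
qed simp

definition graph_value :: "('v \<times> 'g) list set set \<Rightarrow> 'x \<Rightarrow> complex" where
  "graph_value = graph_multiplier V E G X \<alpha> (\<lambda>v. curry (ht v))"

text \<open>The definition takes an arbitrary reduced expression; by \<open>normal_form\<close> it differs from \<open>w\<close> only by
  exchanges, which do not change the value.\<close>

lemma graph_value_reduced:
  assumes w: "w \<in> reduced_words" and x: "x \<in> S"
  shows "graph_value (prod_word w) x = wmult w x"
proof (cases "prod_word w = \<one>\<^bsub>P\<^esub>")
  case True
  then have "shuffle E w []"
    by (intro normal_form w Nil_reduced_words) (simp add: word_prod_Nil)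
  then have "w = []" using shuffle_set by fastforce
  then show ?thesis by (simp add: graph_value_def graph_multiplier_def word_prod_Nil)
next
  case False
  have iff: "reduced_expression V E G s z \<longleftrightarrow> z \<in> reduced_words \<and> prod_word z = s" for s z
    by (auto simp: reduced_expression_def reduced_words_def)
  define z where "z = (SOME z. reduced_expression V E G (prod_word w) z)"
  have "reduced_expression V E G (prod_word w) z"
    unfolding z_def by (rule someI[of _ w]) (simp add: iff w)
  then have z: "z \<in> reduced_words" "prod_word z = prod_word w" by (simp_all add: iff)
  have "graph_value (prod_word w) x = wmult z x"
    using False word_multiplier_eq_wmult[OF reduced_words_letters[OF z(1)] x]
    by (simp add: graph_value_def graph_multiplier_def z_def)
  also have "\<dots> = wmult w x"
    by (rule shuffle_wmult[OF normal_form[OF z(1) w z(2)] reduced_words_letters[OF z(1)] x])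
  finally show ?thesis .
qed

text \<open>The words over the neighbours of \<open>v\<close>. Their letters commute with \<open>G v\<close>, both in the group and as
  homeomorphisms, and neither side affects the values of the other.\<close>

definition link_words :: "'v \<Rightarrow> ('v \<times> 'g) list set" where
  "link_words v = {c. set c \<subseteq> letters \<and> fst ` set c \<subseteq> {x. (v, x) \<in> E}}"

lemma link_words_letters: "c \<in> link_words v \<Longrightarrow> set c \<subseteq> letters"
  by (simp add: link_words_def)

lemma link_words_simps:
  "(x, a) # c \<in> link_words v \<longleftrightarrow> (v, x) \<in> E \<and> x \<in> V \<and> a \<in> carrier (G x) \<and> c \<in> link_words v"
  "c @ d \<in> link_words v \<longleftrightarrow> c \<in> link_words v \<and> d \<in> link_words v"
  by (auto simp: link_words_def)

lemma link_words_inv: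
  assumes "c \<in> link_words v" shows "inv_word c \<in> link_words v"
proof -
  have "set (map fst (inv_word c)) = fst ` set c" by (simp add: map_fst_inv_word)
  then show ?thesis using assms inv_word_letters by (auto simp: link_words_def)
qed

lemma link_move:
  assumes "c \<in> link_words v" "v \<in> V" "g \<in> carrier (G v)" "x \<in> S"
  shows "move c (\<alpha> v g x) = \<alpha> v g (move c x)"
  using assms
proof (induction c)
  case (Cons a c)
  obtain y k where a: "a = (y, k)" by force
  have "set c \<subseteq> letters" using Cons.prems(1) link_words_letters[of c v] by (simp add: a link_words_simps)
  then show ?case using Cons
    by (simp add: a link_words_simps move_Cons \<alpha>_closed move_closed \<alpha>_commute[of v y])
qed (simp add: move_Nil \<alpha>_closed)

lemma link_wmult:
  assumes "c \<in> link_words v" "v \<in> V" "g \<in> carrier (G v)" "x \<in> S"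
  shows "wmult c (\<alpha> v g x) = wmult c x"
  using assms
proof (induction c)
  case (Cons a c)
  obtain y k where a: "a = (y, k)" by force
  have "set c \<subseteq> letters" using Cons.prems(1) link_words_letters[of c v] by (simp add: a link_words_simps)
  then show ?case using Cons
    by (simp add: a link_words_simps link_move move_closed ht_invariant[OF E_symD])
qed simp

lemma link_ht:
  assumes "c \<in> link_words v" "g \<in> carrier (G v)" "x \<in> S"
  shows "ht v (g, move c x) = ht v (g, x)"
  using assms
proof (induction c)
  case (Cons a c)
  obtain y k where a: "a = (y, k)" by force
  have "set c \<subseteq> letters" using Cons.prems(1) link_words_letters[of c v] by (simp add: a link_words_simps)
  then show ?case using Cons
    by (simp add: a link_words_simps move_Cons move_closed ht_invariant[of v y])
qed (simp add: move_Nil)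

lemma link_word_prod:
  assumes "c \<in> link_words v" "v \<in> V" "g \<in> carrier (G v)"
  shows "prod_word (c @ [(v, g)]) = prod_word ((v, g) # c)"
  using assms E_symD
  by (intro shuffle_word_prod shuffle_move) (fastforce simp: link_words_def)+

lemma ex_reduced_link_word:
  assumes "c \<in> link_words v"
  shows "\<exists>z \<in> reduced_words. z \<in> link_words v \<and> prod_word z = prod_word c"
proof -
  obtain z where z: "z \<in> reduced_words" "prod_word z = prod_word c" "subseq (map fst z) (map fst c)"
    using ex_reduced_word[OF link_words_letters[OF assms]] by auto
  have "set (map fst z) \<subseteq> set (map fst c)"
    using z(3) set_nths_subset unfolding subseq_conv_nths by metis
  then have "fst ` set z \<subseteq> fst ` set c" by simp
  then have "fst ` set z \<subseteq> {x. (v, x) \<in> E}" using assms unfolding link_words_def by blast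
  then have "z \<in> link_words v" using reduced_words_letters[OF z(1)] by (simp add: link_words_def)
  then show ?thesis using z by blast
qed

section \<open>Positivity on product sets\<close>

text \<open>The kernel \<open>(s, t) \<mapsto> h(s\<inverse>t, t\<inverse>x)\<close>, with words standing for their group elements. By
  \<open>ker_cong\<close> the choice of the words does not matter.\<close>

definition ker :: "'x \<Rightarrow> ('v \<times> 'g) list \<Rightarrow> ('v \<times> 'g) list \<Rightarrow> complex" where
  "ker x u w = graph_value (prod_word (inv_word u @ w)) (move (inv_word w) x)"

lemma ker_cong:
  assumes "set u \<subseteq> letters" "set w \<subseteq> letters" "set u' \<subseteq> letters" "set w' \<subseteq> letters"
    "prod_word u = prod_word u'" "prod_word w = prod_word w'"
  shows "ker x u w = ker x u' w'"
  using assms by (simp add: ker_def word_prod_append inv_word_letters word_prod_inv_word move_def)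

lemma move_inv_append:
  assumes "set u \<subseteq> letters" "set w \<subseteq> letters" "x \<in> S"
  shows "move (inv_word (u @ w)) x = move (inv_word w) (move (inv_word u) x)"
  using assms by (simp add: inv_word_simps move_append inv_word_letters)

lemma move_inv_Cons:
  assumes "v \<in> V" "g \<in> carrier (G v)" "set w \<subseteq> letters" "x \<in> S"
  shows "move (inv_word ((v, g) # w)) x = move (inv_word w) (\<alpha> v (inv\<^bsub>G v\<^esub> g) x)"
  using assms
  by (simp add: inv_word_simps move_append inv_word_letters G_closed move_Cons move_Nil)

lemma ker_translate:
  assumes v: "v \<in> V" "g \<in> carrier (G v)" and u: "set u \<subseteq> letters" "set w \<subseteq> letters" and x: "x \<in> S"
  shows "ker x ((v, g) # u) ((v, g) # w) = ker (\<alpha> v (inv\<^bsub>G v\<^esub> g) x) u w"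
proof -
  let ?i = "graph_inj V E G v g"
  have c: "?i \<in> carrier P" "prod_word u \<in> carrier P" "prod_word w \<in> carrier P"
    using v u by (simp_all add: inj_closed word_prod_closed)
  have "prod_word (inv_word ((v, g) # u) @ (v, g) # w) = inv\<^bsub>P\<^esub> prod_word u \<otimes>\<^bsub>P\<^esub> (inv\<^bsub>P\<^esub> ?i \<otimes>\<^bsub>P\<^esub> (?i \<otimes>\<^bsub>P\<^esub> prod_word w))"
    using v u c by (simp add: word_prod_append inv_word_letters word_prod_inv_word word_prod_Cons
        P.inv_mult_group P.m_assoc)
  also have "\<dots> = prod_word (inv_word u @ w)"
    using u c by (simp add: word_prod_append inv_word_letters word_prod_inv_word flip: P.m_assoc)
  finally show ?thesis using v u x by (simp add: ker_def move_inv_Cons)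
qed

lemma ker_link:
  assumes c: "c \<in> link_words v" "d \<in> link_words v" and v: "v \<in> V" "g \<in> carrier (G v)" and x: "x \<in> S"
  shows "ker (\<alpha> v g x) c d = ker x c d"
proof -
  have "inv_word c @ d \<in> link_words v" using c by (simp add: link_words_simps link_words_inv)
  then obtain z where z: "z \<in> reduced_words" "z \<in> link_words v" "prod_word z = prod_word (inv_word c @ d)"
    using ex_reduced_link_word by blast
  have d: "inv_word d \<in> link_words v" "set (inv_word d) \<subseteq> letters"
    using link_words_inv[OF c(2)] link_words_letters by auto
  show ?thesis
    using v x d z
    by (simp add: ker_def z(3)[symmetric] link_move graph_value_reduced move_closed \<alpha>_closed link_wmult)
qed

text \<open>In terms of vectors \<open>e\<^sub>s\<close> with this Gram matrix: the projection of \<open>e\<^bsub>dq\<^esub>\<close> to the span of the \<open>e\<^sub>c\<close> with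
  \<open>c\<close> over the neighbours of \<open>v\<close> is a multiple of \<open>e\<^sub>d\<close>. The reason is that a reduced word of \<open>c\<inverse>d\<close> stays
  reduced when \<open>q\<close> is appended.\<close>

lemma ker_link_left:
  assumes c: "c \<in> link_words v" "d \<in> link_words v" and q: "q \<in> reduced_words" "star_free v q" and x: "x \<in> S"
  shows "ker x c (d @ q) = ker x c d * wmult q (move (inv_word (d @ q)) x)"
proof -
  have "inv_word c @ d \<in> link_words v" using c by (simp add: link_words_simps link_words_inv)
  then obtain z where z: "z \<in> reduced_words" "z \<in> link_words v" "prod_word z = prod_word (inv_word c @ d)"
    using ex_reduced_link_word by blast
  have l: "set c \<subseteq> letters" "set d \<subseteq> letters" "set z \<subseteq> letters" "set q \<subseteq> letters"
    "set (inv_word c) \<subseteq> letters" "set (inv_word d) \<subseteq> letters" "set (inv_word q) \<subseteq> letters"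
    using link_words_letters[OF c(1)] link_words_letters[OF c(2)] reduced_words_letters[OF z(1)]
      reduced_words_letters[OF q(1)] inv_word_letters by auto
  define y where "y = move (inv_word (d @ q)) x"
  have y: "y \<in> S" unfolding y_def using l x by (intro move_closed inv_word_letters) auto
  have qy: "move q y = move (inv_word d) x"
    using l x by (simp add: y_def move_inv_append move_move_inv move_closed)
  have zq: "z @ q \<in> reduced_words"
    using z q by (intro reduced_commuting_append) (auto simp: link_words_def)
  have "prod_word (inv_word c @ d @ q) = prod_word (z @ q)"
    using l z(3) word_prod_append[of "inv_word c @ d" q] word_prod_append[of z q] by simp
  then have "ker x c (d @ q) = wmult (z @ q) y"
    by (simp only: ker_def y_def[symmetric] graph_value_reduced[OF zq y])
  also have "\<dots> = wmult z (move (inv_word d) x) * wmult q y"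
    using l y by (simp add: wmult_append qy)
  also have "wmult z (move (inv_word d) x) = ker x c d"
    using l x z by (simp add: ker_def z(3)[symmetric] graph_value_reduced move_closed)
  finally show ?thesis by (simp add: y_def)
qed

text \<open>With \<open>b = g\<inverse>k\<close> and a reduced word \<open>z\<close> of \<open>c\<inverse>d\<close>, the word \<open>p\<inverse> z b q\<close> is reduced and represents the product
  of the inverse of the first argument with the second one. Its value is a product of four
  factors. The letter \<open>b\<close> is evaluated at a point that the link words do not matter for, and likewise \<open>z\<close> at a
  point that \<open>G v\<close> does not matter for, which turns them into the two kernels.\<close>

lemma ker_across:
  assumes c: "c \<in> link_words v" "d \<in> link_words v"
    and p: "p \<in> reduced_words" "star_free v p" and q: "q \<in> reduced_words" "star_free v q"
    and v: "v \<in> V" and g: "g \<in> carrier (G v)" "k \<in> carrier (G v)" "g \<noteq> k" and x: "x \<in> S"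
  shows "ker x ((v, g) # c @ p) ((v, k) # d @ q)
    = cnj (wmult p (move (inv_word ((v, g) # c @ p)) x))
      * (ht v (inv\<^bsub>G v\<^esub> g \<otimes>\<^bsub>G v\<^esub> k, \<alpha> v (inv\<^bsub>G v\<^esub> k) x) * ker x c d)
      * wmult q (move (inv_word ((v, k) # d @ q)) x)"
proof -
  interpret Gv: group "G v" by (rule group_G[OF v])
  let ?b = "inv\<^bsub>G v\<^esub> g \<otimes>\<^bsub>G v\<^esub> k"
  have b: "?b \<in> carrier (G v)" "?b \<noteq> \<one>\<^bsub>G v\<^esub>"
  proof -
    show "?b \<in> carrier (G v)" using g by simp
    show "?b \<noteq> \<one>\<^bsub>G v\<^esub>"
    proof
      assume "?b = \<one>\<^bsub>G v\<^esub>"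
      then have "inv\<^bsub>G v\<^esub> (inv\<^bsub>G v\<^esub> g) = k" using g by (metis Gv.inv_closed Gv.inv_equality Gv.inv_comm)
      then show False using g by simp
    qed
  qed
  have cd: "inv_word c @ d \<in> link_words v" using c by (simp add: link_words_simps link_words_inv)
  then obtain z where z: "z \<in> reduced_words" "z \<in> link_words v" "prod_word z = prod_word (inv_word c @ d)"
    using ex_reduced_link_word by blast
  have id: "inv_word d \<in> link_words v" "inv_word c \<in> link_words v" using c link_words_inv by auto
  have l: "set c \<subseteq> letters" "set d \<subseteq> letters" "set z \<subseteq> letters" "set q \<subseteq> letters" "set p \<subseteq> letters"
    "set (inv_word c) \<subseteq> letters" "set (inv_word d) \<subseteq> letters" "set (inv_word q) \<subseteq> letters"
    "set (inv_word p) \<subseteq> letters"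
    using link_words_letters[OF c(1)] link_words_letters[OF c(2)] reduced_words_letters[OF z(1)]
      reduced_words_letters[OF q(1)] reduced_words_letters[OF p(1)] inv_word_letters by auto
  let ?W = "inv_word p @ z @ (v, ?b) # q"
  have W: "?W \<in> reduced_words"
    by (rule reduced_sandwich[OF z(1) _ p q v b]) (use z(2) in \<open>simp add: link_words_def\<close>)
  let ?u = "(v, g) # c @ p" and ?w = "(v, k) # d @ q"
  define u0 y where "u0 = move (inv_word ?u) x" and "y = move (inv_word ?w) x"
  define xk xg where "xk = \<alpha> v (inv\<^bsub>G v\<^esub> k) x" and "xg = \<alpha> v (inv\<^bsub>G v\<^esub> g) x"
  have xk: "xk \<in> S" "xg \<in> S" using v g x by (simp_all add: xk_def xg_def \<alpha>_closed)
  have y_eq: "y = move (inv_word q) (move (inv_word d) xk)" and u0_eq: "u0 = move (inv_word p) (move (inv_word c) xg)"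
    using v g l x xk by (simp_all add: y_def u0_def move_inv_Cons move_inv_append xk_def xg_def)
  have y: "y \<in> S" "u0 \<in> S" using l xk by (simp_all add: y_eq u0_eq move_closed)
  have qy: "move q y = move (inv_word d) xk" and pu: "move p u0 = move (inv_word c) xg"
    using l xk by (simp_all add: y_eq u0_eq move_move_inv move_closed)
  let ?i = "graph_inj V E G v"
  have prodW: "prod_word (inv_word ?u @ ?w) = prod_word ?W"
  proof -
    have cl: "?i (inv\<^bsub>G v\<^esub> g) \<in> carrier P" "?i k \<in> carrier P" "?i ?b \<in> carrier P"
      using v g b by (simp_all add: inj_closed)
    note pc = l[THEN word_prod_closed]
    have comm: "prod_word d \<otimes>\<^bsub>P\<^esub> ?i ?b = ?i ?b \<otimes>\<^bsub>P\<^esub> prod_word d"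
      using link_word_prod[OF c(2) v b(1)] l v b cl
      by (simp add: word_prod_append word_prod_Cons word_prod_Nil)
    have "prod_word (inv_word ?u @ ?w)
        = prod_word (inv_word p) \<otimes>\<^bsub>P\<^esub> (prod_word (inv_word c) \<otimes>\<^bsub>P\<^esub> (?i ?b \<otimes>\<^bsub>P\<^esub> prod_word d)) \<otimes>\<^bsub>P\<^esub> prod_word q"
      using v g l cl pc
      by (simp add: inv_word_simps word_prod_append word_prod_Cons word_prod_Nil inj_mult[symmetric] P.m_assoc)
    also have "\<dots> = prod_word ?W"
      using v g l cl pc b z(3)
      by (simp add: word_prod_append word_prod_Cons comm[symmetric] P.m_assoc)
    finally show ?thesis .
  qed
  have dx: "move (inv_word d) x \<in> S" "move (inv_word d) xk \<in> S" using l x xk by (simp_all add: move_closed)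
  have "ker x ?u ?w = wmult ?W y"
    by (simp only: ker_def prodW y_def[symmetric] graph_value_reduced[OF W y(1)])
  also have "\<dots> = wmult (inv_word p) (move (z @ (v, ?b) # q) y) * (wmult z (move ((v, ?b) # q) y)
      * (ht v (?b, move q y) * wmult q y))"
    using l y v b by (simp add: wmult_append)
  also have "ht v (?b, move q y) = ht v (?b, xk)"
    using link_ht[OF id(1) b(1) xk(1)] by (simp add: qy)
  also have bq: "move ((v, ?b) # q) y = \<alpha> v ?b (move (inv_word d) xk)"
    using v b l y by (simp add: move_Cons qy)
  also have "wmult z (\<alpha> v ?b (move (inv_word d) xk)) = ker x c d"
  proof -
    have "wmult z (\<alpha> v ?b (move (inv_word d) xk)) = wmult z (\<alpha> v (inv\<^bsub>G v\<^esub> k) (move (inv_word d) x))"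
      using link_wmult[OF z(2) v b(1) dx(2)] link_move[OF id(1) v _ x, of "inv\<^bsub>G v\<^esub> k"] g by (simp add: xk_def)
    also have "\<dots> = wmult z (move (inv_word d) x)" using link_wmult[OF z(2) v _ dx(1)] g by simp
    also have "\<dots> = ker x c d"
      by (simp only: ker_def z(3)[symmetric] graph_value_reduced[OF z(1) dx(1)])
    finally show ?thesis .
  qed
  also have "move (z @ (v, ?b) # q) y = move p u0"
  proof -
    have "move (z @ (v, ?b) # q) y = move z (\<alpha> v ?b (move (inv_word d) xk))"
      using l v b y by (simp add: move_append bq)
    also have "\<dots> = move (inv_word c) (move d (\<alpha> v ?b (move (inv_word d) xk)))"
      using move_cong[OF z(3)] l dx v b by (simp add: move_append \<alpha>_closed)
    also have "\<dots> = move (inv_word c) (\<alpha> v ?b xk)"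
      using link_move[OF c(2) v b(1) dx(2)] l xk by (simp add: move_move_inv)
    also have "\<alpha> v ?b xk = xg"
      using v g x by (simp add: xk_def xg_def \<alpha>_mult Gv.m_assoc)
    finally show ?thesis by (simp add: pu)
  qed
  also have "wmult (inv_word p) (move p u0) = cnj (wmult p u0)"
    using l y by (simp add: wmult_inv_word)
  finally show ?thesis by (simp add: u0_def y_def xk_def mult_ac)
qed

text \<open>In the notation of the proof, the kernel is the sum of two positive kernels: the product of the kernel of
  \<open>G v\<close> with the one of the link parts, scaled by \<open>b\<close>, and on each coset given by a value of \<open>g\<close> the Gram
  matrix of the vectors of \<open>r\<close> minus their projections to the link parts. For different values of \<open>g\<close> only
  the first summand contributes, by \<open>ker_across\<close>; for equal ones the first summand cancels against the
  projections.\<close>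

lemma pos_kernel_ker_step:
  assumes v: "v \<in> V" and IH: "\<And>x. x \<in> S \<Longrightarrow> pos_kernel (words_below vs) (ker x)" and x: "x \<in> S"
  shows "pos_kernel (words_below (v # vs)) (ker x)"
proof -
  interpret Gv: group "G v" by (rule group_G[OF v])
  let ?T = "words_below (v # vs)"
  have "\<forall>w\<in>?T. \<exists>t. case t of (g, c, p, r) \<Rightarrow> g \<in> carrier (G v) \<and> prod_word w = prod_word ((v, g) # c @ p)
    \<and> c \<in> reduced_words \<and> fst ` set c \<subseteq> {x. (v, x) \<in> E} \<and> p \<in> reduced_words \<and> star_free v p
    \<and> c \<in> words_below vs \<and> r \<in> words_below vs \<and> prod_word r = prod_word (c @ p)"
    using amalgam_decomposition[OF _ v] by fastforce
  from bchoice[OF this] obtain f where f: "\<forall>w\<in>?T. case f w of (g, c, p, r) \<Rightarrow> g \<in> carrier (G v) \<and> prod_word w = prod_word ((v, g) # c @ p)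
    \<and> c \<in> reduced_words \<and> fst ` set c \<subseteq> {x. (v, x) \<in> E} \<and> p \<in> reduced_words \<and> star_free v p
    \<and> c \<in> words_below vs \<and> r \<in> words_below vs \<and> prod_word r = prod_word (c @ p)" ..
  define g c p r where "g w = fst (f w)" and "c w = fst (snd (f w))" and "p w = fst (snd (snd (f w)))"
    and "r w = snd (snd (snd (f w)))" for w
  have d: "g w \<in> carrier (G v)" "prod_word w = prod_word ((v, g w) # c w @ p w)" "c w \<in> link_words v"
    "p w \<in> reduced_words" "star_free v (p w)" "c w \<in> words_below vs" "r w \<in> words_below vs"
    "prod_word (r w) = prod_word (c w @ p w)" "set (c w) \<subseteq> letters" "set (p w) \<subseteq> letters"
    "set (r w) \<subseteq> letters" "set w \<subseteq> letters" if "w \<in> ?T" for w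
    using bspec[OF f that] that reduced_words_letters
    by (auto simp: g_def c_def p_def r_def case_prod_beta link_words_def words_below_def)
  \<comment> \<open>the coefficient of the projection to the link part\<close>
  define b where "b w = wmult (p w) (move (inv_word w) x)" for w
  define y where "y w = \<alpha> v (inv\<^bsub>G v\<^esub> (g w)) x" for w
  have y: "y w \<in> S" if "w \<in> ?T" for w using d[OF that] v x by (simp add: y_def \<alpha>_closed)
  have inv_cong: "move (inv_word w) x = move (inv_word ((v, g w) # c w @ p w)) x" if "w \<in> ?T" for w
    using d[OF that] v by (simp add: move_def word_prod_inv_word del: inv_word_simps)
  have b_eq: "b w = wmult (p w) (move (inv_word (c w @ p w)) (y w))" if "w \<in> ?T" for w
    using d[OF that] v x inv_cong[OF that] by (simp add: b_def move_inv_Cons y_def)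
  define A where "A u w = ht v (inv\<^bsub>G v\<^esub> (g u) \<otimes>\<^bsub>G v\<^esub> g w, \<alpha> v (inv\<^bsub>G v\<^esub> (g w)) x) * ker x (c u) (c w)" for u w
  define B where "B u w = ker (y w) (r u) (r w) - cnj (b u) * ker (y w) (c u) (c w) * b w" for u w
  have A: "pos_kernel ?T (\<lambda>u w. cnj (b u) * A u w * b w)"
    unfolding A_def
    by (intro pos_kernel_scale pos_kernel_times pos_kernel_pullback[OF vertex_kernel[OF v x]]
        pos_kernel_pullback[OF IH[OF x]] d)
  have B: "pos_kernel ?T (\<lambda>u w. if g u = g w then B u w else 0)"
  proof (rule pos_kernel_blocks)
    fix a
    let ?Ta = "{w \<in> ?T. g w = a}"
    show "pos_kernel ?Ta B"
    proof (cases "a \<in> carrier (G v)")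
      case True
      define ya where "ya = \<alpha> v (inv\<^bsub>G v\<^esub> a) x"
      have ya: "ya \<in> S" "\<And>w. g w = a \<Longrightarrow> y w = ya"
        using True v x by (simp_all add: ya_def y_def \<alpha>_closed)
      have "pos_kernel ?Ta (\<lambda>u w. ker ya (r u) (r w) - cnj (b u) * ker ya (c u) (c w) * b w)"
      proof (rule pos_kernel_difference[OF IH[OF ya(1)]])
        fix u w assume uw: "u \<in> ?Ta" "w \<in> ?Ta"
        then have u: "u \<in> ?T" and w: "w \<in> ?T" by auto
        have "ker ya (c u) (r w) = ker ya (c u) (c w @ p w)"
          using d[OF u] d[OF w] by (intro ker_cong) auto
        also have "\<dots> = ker ya (c u) (c w) * b w"
          using ker_link_left[OF d(3)[OF u] d(3)[OF w] d(4,5)[OF w] ya(1)] b_eq[OF w] ya(2)[of w] uw by simp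
        finally show "ker ya (c u) (r w) = ker ya (c u) (c w) * b w" .
      qed (use d in auto)
      also have "?this \<longleftrightarrow> pos_kernel ?Ta B"
        by (rule pos_kernel_cong) (simp add: B_def ya)
      finally show ?thesis .
    next
      case False
      then have "?Ta = {}" using d by auto
      then show ?thesis by (simp only:) (simp add: pos_kernel_def psd_on_def)
    qed
  qed
  have "pos_kernel ?T (\<lambda>u w. cnj (b u) * A u w * b w + (if g u = g w then B u w else 0))"
    by (rule pos_kernel_add[OF A B])
  also have "?this \<longleftrightarrow> pos_kernel ?T (ker x)"
  proof (rule pos_kernel_cong)
    fix u w assume u: "u \<in> ?T" and w: "w \<in> ?T"
    have *: "ker x u w = ker x ((v, g u) # c u @ p u) ((v, g w) # c w @ p w)"
      using d[OF u] d[OF w] v by (intro ker_cong) auto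
    show "cnj (b u) * A u w * b w + (if g u = g w then B u w else 0) = ker x u w"
    proof (cases "g u = g w")
      case True
      have "ker x u w = ker (y w) (c u @ p u) (c w @ p w)"
        unfolding * True y_def using d[OF u] d[OF w] v x by (intro ker_translate) auto
      also have "\<dots> = ker (y w) (r u) (r w)"
        using d[OF u] d[OF w] by (intro ker_cong) auto
      moreover have "ker (y w) (c u) (c w) = ker x (c u) (c w)"
        unfolding y_def using d[OF u] d[OF w] v x by (intro ker_link) auto
      moreover have "A u w = ker x (c u) (c w)"
        using True d[OF w] v x by (simp add: A_def ht_one \<alpha>_closed)
      ultimately show ?thesis using True by (simp add: B_def)
    next
      case False
      have "ker x u w = cnj (b u) * A u w * b w"
        unfolding * b_def inv_cong[OF u] inv_cong[OF w] A_def
        by (rule ker_across) (use d[OF u] d[OF w] v x False in auto)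
      then show ?thesis using False by simp
    qed
  qed
  finally show ?thesis .
qed

lemma pos_kernel_ker:
  assumes "set vs \<subseteq> V" "x \<in> S"
  shows "pos_kernel (words_below vs) (ker x)"
  using assms
proof (induction vs arbitrary: x)
  case Nil
  have "ker x [] [] = 1"
    using graph_value_reduced[OF Nil_reduced_words Nil.prems(2)] Nil.prems(2)
    by (simp add: ker_def inv_word_simps move_Nil)
  moreover have "words_below [] = {[]}" by (auto simp: words_below_def dest!: list_emb_Nil2)
  ultimately show ?case
    by (auto simp: pos_kernel_def psd_on_def subset_singleton_iff complex_nonneg_Reals_iff)
next
  case (Cons v vs)
  then show ?case by (intro pos_kernel_ker_step) auto
qed

lemma continuous_map_move: "set w \<subseteq> letters \<Longrightarrow> continuous_map X X (move w)"
  using \<beta>_homeo_action word_prod_closed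
  by (auto simp: move_def homeo_action_def intro: homeomorphic_imp_continuous_map)

lemma continuous_map_ht:
  assumes "v \<in> V" "g \<in> carrier (G v)"
  shows "continuous_map X euclidean (\<lambda>x. ht v (g, x))"
proof -
  have "continuous_map X (prod_topology (discrete_topology (carrier (G v))) X) (\<lambda>x. (g, x))"
    using assms by (simp add: continuous_map_pairedI)
  then show ?thesis
    using continuous_map_compose[of _ _ "\<lambda>x. (g, x)" _ "ht v"] pd[OF assms(1)]
    by (auto simp: tg_positive_definite_def comp_def)
qed

lemma continuous_map_wmult: "set w \<subseteq> letters \<Longrightarrow> continuous_map X euclidean (wmult w)"
proof (induction w)
  case (Cons a w)
  obtain v g where a: "a = (v, g)" by force
  have "continuous_map X euclidean (\<lambda>x. ht v (g, move w x))"
    using continuous_map_compose[OF continuous_map_move continuous_map_ht] Cons.prems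
    by (auto simp: a comp_def)
  moreover have "continuous_map X euclidean (wmult w)" using Cons by simp
  ultimately have "continuous_map X euclidean (\<lambda>x. ht v (g, move w x) * wmult w x)"
    by (simp add: continuous_map_atin tendsto_mult)
  then show ?case by (simp add: a)
next
  case Nil
  have "wmult [] = (\<lambda>x. 1)" by (simp add: fun_eq_iff)
  then show ?case by simp
qed

theorem graph_tg_function_positive_definite:
  "tg_positive_definite P X (graph_action V E G X \<alpha>) (graph_tg_function V E G X \<alpha> ht)"
proof -
  have fun_eq: "graph_tg_function V E G X \<alpha> ht (s, x) = graph_value s x" for s x
    by (simp add: graph_tg_function_def graph_value_def)
  have cont: "continuous_map X euclidean (graph_value s)" if s: "s \<in> carrier P" for s
  proof -
    obtain w where "set w \<subseteq> letters" "prod_word w = s" using ex_word[OF s] by blast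
    then obtain z where z: "z \<in> reduced_words" "prod_word z = s" using ex_reduced_word by metis
    show ?thesis
      using continuous_map_wmult[OF reduced_words_letters[OF z(1)]]
      by (rule continuous_map_eq) (simp add: z(2)[symmetric] graph_value_reduced[OF z(1)])
  qed
  have "continuous_map (prod_topology (discrete_topology (carrier P)) X) euclidean
      (graph_tg_function V E G X \<alpha> ht)"
    unfolding continuous_map
  proof (intro conjI allI impI)
    fix U :: "complex set" assume U: "openin euclidean U"
    have eq: "{p \<in> topspace (prod_topology (discrete_topology (carrier P)) X). graph_tg_function V E G X \<alpha> ht p \<in> U}
      = (\<Union>s\<in>carrier P. {s} \<times> {x \<in> S. graph_value s x \<in> U})"
      by (auto simp: fun_eq)
    show "openin (prod_topology (discrete_topology (carrier P)) X)
      {p \<in> topspace (prod_topology (discrete_topology (carrier P)) X). graph_tg_function V E G X \<alpha> ht p \<in> U}"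
      unfolding eq
      by (intro openin_Union) (auto simp: openin_prod_Times_iff intro!: openin_continuous_map_preimage[OF cont U])
  qed auto
  moreover have "psd_matrix n (\<lambda>i j. graph_tg_function V E G X \<alpha> ht
      (tg_mult P (tg_inv P (graph_action V E G X \<alpha>) (\<eta> i)) (\<eta> j)))"
    if x: "x \<in> S" and \<eta>: "\<forall>i<n. \<eta> i \<in> tg_arrows P X \<and> tg_range (graph_action V E G X \<alpha>) (\<eta> i) = x"
    for x n and \<eta> :: "nat \<Rightarrow> ('v \<times> 'g) list set set \<times> 'x"
  proof -
    have "\<forall>i\<in>{..<n}. \<exists>w. set w \<subseteq> letters \<and> prod_word w = fst (\<eta> i)"
      using \<eta> ex_word by (auto simp: tg_arrows_def)
    then obtain w where w: "\<forall>i\<in>{..<n}. set (w i) \<subseteq> letters \<and> prod_word (w i) = fst (\<eta> i)"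
      using bchoice by meson
    \<comment> \<open>one product set that contains all the given elements\<close>
    define vs where "vs = concat (map (\<lambda>i. map fst (w i)) [0..<n])"
    have vs: "set vs \<subseteq> V" using w by (fastforce simp: vs_def)
    have "w i \<in> words_below vs" if "i < n" for i
    proof -
      have "i \<in> set [0..<n]" using that by simp
      then obtain ys zs where "[0..<n] = ys @ i # zs" by (metis split_list)
      then have "subseq (map fst (w i)) vs" by (auto simp: vs_def)
      then show ?thesis using w that by (auto simp: words_below_def)
    qed
    then have "psd_matrix n (\<lambda>i j. ker x (w i) (w j))"
      by (intro pos_kernel_psd_matrix[OF pos_kernel_ker[OF vs x]])
    moreover have "ker x (w i) (w j) = graph_tg_function V E G X \<alpha> ht
        (tg_mult P (tg_inv P (graph_action V E G X \<alpha>) (\<eta> i)) (\<eta> j))" if "i < n" "j < n" for i j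
    proof -
      have l: "set (w i) \<subseteq> letters" "set (w j) \<subseteq> letters" "prod_word (w i) = fst (\<eta> i)" "prod_word (w j) = fst (\<eta> j)"
        using w that by auto
      have "snd (\<eta> j) \<in> S" "move (w j) (snd (\<eta> j)) = x"
        using \<eta> that l by (auto simp: tg_arrows_def tg_range_def move_def \<beta>_def)
      then have "move (inv_word (w j)) x = snd (\<eta> j)" using l move_inv_move by metis
      then show ?thesis
        using l by (simp add: ker_def fun_eq tg_mult_def tg_inv_def word_prod_append inv_word_letters word_prod_inv_word)
    qed
    ultimately show ?thesis by (simp add: psd_matrix_def)
  qed
  ultimately show ?thesis by (auto simp: tg_positive_definite_def)
qed

end

theorem corollary5p2:
  fixes V :: "'v set" and E :: "('v \<times> 'v) set"
    and G :: "'v \<Rightarrow> ('g, 'm) monoid_scheme"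
    and X :: "'x topology"
    and \<alpha> :: "'v \<Rightarrow> 'g \<Rightarrow> 'x \<Rightarrow> 'x"
    and ht :: "'v \<Rightarrow> 'g \<times> 'x \<Rightarrow> complex"
  assumes "simplicial_graph V E"
    and "compact_space X" and "Hausdorff_space X"
    and "\<And>v. v \<in> V \<Longrightarrow> group (G v)"
    and "\<And>v. v \<in> V \<Longrightarrow> homeo_action (G v) X (\<alpha> v)"
    and "\<And>v. v \<in> V \<Longrightarrow> tg_positive_definite (G v) X (\<alpha> v) (ht v)"
    and "\<And>v. v \<in> V \<Longrightarrow> tg_unital (G v) X (ht v)"
    and "actions_commute E G X \<alpha>"
    and "multipliers_commute E G X \<alpha> (\<lambda>v. curry (ht v))"
  shows "tg_positive_definite (graph_product V E G) X (graph_action V E G X \<alpha>)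
           (graph_tg_function V E G X \<alpha> ht)"
proof -
  interpret graph_of_pd_functions V E G X \<alpha> ht
    by (intro graph_of_pd_functions.intro graph_of_groups.intro graph_of_pd_functions_axioms.intro assms)
  show ?thesis by (rule graph_tg_function_positive_definite)
qed

end
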